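(* Let $K\subset\mathbb{R}^d$ be compact, and let $k:\mathbb{R}^d\times\mathbb{R}^d\to\mathbb{R}$ be a positive-definite kernel of the form $$k(x,y)=h(x)\,k'(x-y)\,h(y)=\mathbb{E}_{\omega\sim\mathcal{N}(0,I_d)}\big[\phi(\omega,x)^\top\phi(\omega,y)\big],\qquad \phi(\omega,x)=h(x)\,\psi(\omega^\top x),$$ where $h:\mathbb{R}^d\to\mathbb{R}$ is continuous, $k':\mathbb{R}^d\to\mathbb{R}$, and $\psi:\mathbb{R}\to\mathbb{R}^D$. Assume that $\phi:\mathbb{R}^d\times\mathbb{R}^d\to\mathbb{R}^D$ is continuous and that $g(\omega):=\sup_{x\in K}\|\phi(\omega,x)\|^2$ is finite for every $\omega\in\mathbb{R}^d$ and satisfies $\mathbb{E}_{\omega\sim\mathcal{N}(0,I_d)}[g(\omega)]<\infty$. Let $\sigma$ be a Lipschitz, unbounded, non-polynomial activation function (e.g. ReLU) used in $\psi_{NN}$, and let $\tilde\sigma$ be a Lipschitz, non-polynomial activation function used in $h_{NN}$. Then for every $\epsilon>0$ there exist one-hidden-layer MLPs $h_{NN}:\mathbb{R}^d\to\mathbb{R}$ (activation $\tilde\sigma$) and $\psi_{NN}:\mathbb{R}\to\mathbb{R}^D$ (activation $\sigma$) such that, with $$\phi_{NN}(\omega,x):=h_{NN}(x)\,\psi_{NN}(\omega^\top x),\qquad k_{NN}(x,y):=\mathbb{E}_{\omega\sim\mathcal{N}(0,I_d)}\big[\phi_{NN}(\omega,x)\cdot\phi_{NN}(\omega,y)\big],$$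 one has $|k(x,y)-k_{NN}(x,y)|\le\epsilon$ for all $x,y\in K$.
   Context: A one-hidden-layer MLP $\mathbb{R}^p\to\mathbb{R}^q$ with activation $\sigma$ is a map $z\mapsto A\,\sigma(Wz+b)$ with $w\in\mathbb{N}$, $W\in\mathbb{R}^{w\times p}$, $b\in\mathbb{R}^w$, $A\in\mathbb{R}^{q\times w}$, where $\sigma$ acts componentwise. A positive-definite kernel is a symmetric function $k$ with $\sum_{i,j}c_ic_jk(x_i,x_j)\ge0$ for all finite families of reals $c_i$ and points $x_i$. *)

theory Defs
  imports "HOL-Probability.Probability" "HOL-Computational_Algebra.Polynomial"
begin

text \<open>The standard normal distribution on the space of \<open>d\<close>-vectors, given by its Lebesgue
  density, the product of the one-dimensional standard normal densities.\<close>

definition std_gaussian :: "(real ^ 'd) measure" where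
  "std_gaussian =
     density lborel (\<lambda>\<omega>. ennreal (\<Prod>i\<in>UNIV. std_normal_density (\<omega> $ i)))"

definition positive_definite_kernel :: "('a \<Rightarrow> 'a \<Rightarrow> real) \<Rightarrow> bool" where
  "positive_definite_kernel k \<longleftrightarrow>
     (\<forall>x y. k x y = k y x) \<and>
     (\<forall>(n::nat) (c :: nat \<Rightarrow> real) (x :: nat \<Rightarrow> 'a).
        (\<Sum>i<n. \<Sum>j<n. c i * c j * k (x i) (x j)) \<ge> 0)"

text \<open>Maps of the form \<open>z \<mapsto> A \<sigma>(W z + b)\<close> of arbitrary finite width \<open>w\<close>.  As the width is a
  number and not a type, the \<open>w \<times> p\<close> matrix \<open>W\<close> is given by its rows \<open>W i\<close>, elements of the
  input space, and the \<open>q \<times> w\<close> matrix \<open>A\<close> by its columns \<open>A i\<close>, elements of the output space.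
  There is no output bias.  The type \<open>real\<close> serves as the one-dimensional space.\<close>

definition one_hidden_layer_mlp ::
    "(real \<Rightarrow> real) \<Rightarrow> ('a::euclidean_space \<Rightarrow> 'b::euclidean_space) \<Rightarrow> bool" where
  "one_hidden_layer_mlp \<sigma> f \<longleftrightarrow>
     (\<exists>(w::nat) (W :: nat \<Rightarrow> 'a) (b :: nat \<Rightarrow> real) (A :: nat \<Rightarrow> 'b).
        \<forall>z. f z = (\<Sum>i<w. \<sigma> (W i \<bullet> z + b i) *\<^sub>R A i))"

definition lipschitz :: "(real \<Rightarrow> real) \<Rightarrow> bool" where
  "lipschitz \<sigma> \<longleftrightarrow> (\<exists>C. C-lipschitz_on UNIV \<sigma>)"

definition non_polynomial :: "(real \<Rightarrow> real) \<Rightarrow> bool" where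
  "non_polynomial \<sigma> \<longleftrightarrow> \<not> (\<exists>p. \<forall>t. \<sigma> t = poly p t)"

definition feature ::
    "(real ^ 'd \<Rightarrow> real) \<Rightarrow> (real \<Rightarrow> real ^ 'D) \<Rightarrow> real ^ 'd \<Rightarrow> real ^ 'd \<Rightarrow> real ^ 'D" where
  "feature h \<psi> \<omega> x = h x *\<^sub>R \<psi> (\<omega> \<bullet> x)"

definition feature_kernel ::
    "(real ^ 'd \<Rightarrow> real) \<Rightarrow> (real \<Rightarrow> real ^ 'D) \<Rightarrow> real ^ 'd \<Rightarrow> real ^ 'd \<Rightarrow> real" where
  "feature_kernel h \<psi> x y =
     (LINT \<omega>|std_gaussian. feature h \<psi> \<omega> x \<bullet> feature h \<psi> \<omega> y)"

end

theory Submission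
  imports Defs
begin

text \<open>A network approximating \<open>\<psi>\<close> only on compact sets would not do, since \<open>\<omega> \<bullet> x\<close> is unbounded; instead
  one approximates on the whole line with respect to every Gaussian weight \<open>exp (c * t\<^sup>2)\<close>. For
  Lipschitz non-polynomial \<open>\<sigma>\<close>, this closure of the networks contains all monomials (Taylor expansion
  of moving averages of \<open>\<sigma>\<close>, whose higher derivatives are finite differences of \<open>\<sigma>\<close>), hence, the
  Taylor series of the cosine converging in these weighted norms, all trigonometric sums, hence all bounded
  continuous functions. Trigonometric sums in \<open>a \<bullet> x + b\<close> and Stone-Weierstrass also yield \<open>h\<^sub>N\<^sub>N\<close>.

  Since \<open>x\<close> ranges over a compact set, a small enough \<open>c\<close> makes the weight square integrable
  against the Gaussian, uniformly in \<open>x\<close>. What \<open>\<psi>\<close> does far out costs little, as there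
  the features are dominated by \<open>g\<close>, whose integral over \<open>{\<omega>. norm \<omega> > n}\<close> tends to \<open>0\<close>.\<close>

section \<open>One-hidden-layer networks and their Gaussian-weighted closure\<close>

lemma mlp_zero: "one_hidden_layer_mlp \<sigma> (\<lambda>z. 0)"
  unfolding one_hidden_layer_mlp_def by (rule exI[of _ 0]) simp

lemma mlp_neuron: "one_hidden_layer_mlp \<sigma> (\<lambda>z. \<sigma> (a \<bullet> z + b) *\<^sub>R v)"
  unfolding one_hidden_layer_mlp_def
  by (intro exI[of _ "1::nat"] exI[of _ "\<lambda>_. a"] exI[of _ "\<lambda>_. b"] exI[of _ "\<lambda>_. v"]) simp

lemma mlp_add:
  assumes "one_hidden_layer_mlp \<sigma> f" "one_hidden_layer_mlp \<sigma> g"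
  shows "one_hidden_layer_mlp \<sigma> (\<lambda>z. f z + g z)"
proof -
  obtain n :: nat and W b A where f: "\<forall>z. f z = (\<Sum>i<n. \<sigma> (W i \<bullet> z + b i) *\<^sub>R A i)"
    using assms(1) unfolding one_hidden_layer_mlp_def by blast
  obtain m :: nat and W' b' A' where g: "\<forall>z. g z = (\<Sum>i<m. \<sigma> (W' i \<bullet> z + b' i) *\<^sub>R A' i)"
    using assms(2) unfolding one_hidden_layer_mlp_def by blast
  define U where "U i = (if i < n then W i else W' (i - n))" for i
  define c where "c i = (if i < n then b i else b' (i - n))" for i
  define B where "B i = (if i < n then A i else A' (i - n))" for i
  have split: "(\<Sum>i<n+m. t i) = (\<Sum>i<n. t i) + (\<Sum>i<m. t (n + i))" for t :: "nat \<Rightarrow> 'b"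
    by (induction m) (auto simp: add.assoc)
  have "f z + g z = (\<Sum>i<n+m. \<sigma> (U i \<bullet> z + c i) *\<^sub>R B i)" for z
    using f g by (simp add: split U_def c_def B_def)
  then show ?thesis unfolding one_hidden_layer_mlp_def by blast
qed

lemma mlp_linear_image:
  assumes "one_hidden_layer_mlp \<sigma> f" "linear T"
  shows "one_hidden_layer_mlp \<sigma> (\<lambda>z. T (f z))"
proof -
  obtain n :: nat and W b A where f: "\<forall>z. f z = (\<Sum>i<n. \<sigma> (W i \<bullet> z + b i) *\<^sub>R A i)"
    using assms(1) unfolding one_hidden_layer_mlp_def by blast
  have "T (f z) = (\<Sum>i<n. \<sigma> (W i \<bullet> z + b i) *\<^sub>R T (A i))" for z
    by (simp add: f linear_sum[OF assms(2)] linear_scale[OF assms(2)])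
  then show ?thesis
    unfolding one_hidden_layer_mlp_def
    by (intro exI[of _ n] exI[of _ W] exI[of _ b] exI[of _ "\<lambda>i. T (A i)"]) simp
qed

lemma mlp_sum:
  assumes "finite I" "\<And>i. i \<in> I \<Longrightarrow> one_hidden_layer_mlp \<sigma> (f i)"
  shows "one_hidden_layer_mlp \<sigma> (\<lambda>z. \<Sum>i\<in>I. f i z)"
  using assms by (induction I rule: finite_induct) (auto intro: mlp_zero mlp_add)

text \<open>An affine map in front of the hidden layer is absorbed by the weights and biases. Hence
  networks on the line yield ridge functions on any Euclidean space.\<close>

lemma mlp_ridge:
  fixes N :: "real \<Rightarrow> 'b::euclidean_space" and a :: "'a::euclidean_space"
  assumes "one_hidden_layer_mlp \<sigma> N"
  shows "one_hidden_layer_mlp \<sigma> (\<lambda>x. N (a \<bullet> x + b))"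
proof -
  obtain n :: nat and W c A where f: "\<forall>z. N z = (\<Sum>i<n. \<sigma> (W i \<bullet> z + c i) *\<^sub>R A i)"
    using assms unfolding one_hidden_layer_mlp_def by blast
  have "N (a \<bullet> x + b) = (\<Sum>i<n. \<sigma> ((W i *\<^sub>R a) \<bullet> x + (W i * b + c i)) *\<^sub>R A i)" for x
    by (simp add: f algebra_simps)
  then show ?thesis
    unfolding one_hidden_layer_mlp_def
    by (intro exI[of _ n] exI[of _ "\<lambda>i. W i *\<^sub>R a"] exI[of _ "\<lambda>i. W i * b + c i"] exI[of _ A]) simp
qed

text \<open>The rate \<open>c\<close> is quantified and not fixed: the substitution of
  \<open>w * t + b\<close> can raise the rate, so that stability under affine maps needs arbitrarily
  small rates. The rate used in the end depends on the radius of \<open>K\<close>.\<close>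

definition gauss_closure :: "(real \<Rightarrow> real) \<Rightarrow> (real \<Rightarrow> real) set" where
  "gauss_closure \<sigma> = {f. \<forall>c>0. \<forall>\<delta>>0. \<exists>N. one_hidden_layer_mlp \<sigma> N \<and>
     (\<forall>t. \<bar>f t - N t\<bar> \<le> \<delta> * exp (c * t\<^sup>2))}"

lemma gauss_closureD:
  assumes "f \<in> gauss_closure \<sigma>" "c > 0" "\<delta> > 0"
  obtains N where "one_hidden_layer_mlp \<sigma> N" "\<And>t. \<bar>f t - N t\<bar> \<le> \<delta> * exp (c * t\<^sup>2)"
  using assms unfolding gauss_closure_def by blast

text \<open>Half of the error goes to \<open>g\<close>, the other half to a network for
  \<open>g\<close>. As \<open>g\<close> may depend on \<open>c\<close> and \<open>\<delta>\<close>,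
  later proofs can approximate by members of the closure instead of networks.\<close>

lemma gauss_closure_limit:
  assumes "\<And>c \<delta>. c > 0 \<Longrightarrow> \<delta> > 0 \<Longrightarrow>
             \<exists>g \<in> gauss_closure \<sigma>. \<forall>t. \<bar>f t - g t\<bar> \<le> \<delta> * exp (c * t\<^sup>2)"
  shows "f \<in> gauss_closure \<sigma>"
  unfolding gauss_closure_def
proof safe
  fix c \<delta> :: real assume c: "c > 0" and d: "\<delta> > 0"
  then have d2: "\<delta> / 2 > 0" by simp
  obtain g where g: "g \<in> gauss_closure \<sigma>" "\<And>t. \<bar>f t - g t\<bar> \<le> \<delta>/2 * exp (c * t\<^sup>2)"
    using assms[OF c d2] by blast
  obtain N where N: "one_hidden_layer_mlp \<sigma> N" "\<And>t. \<bar>g t - N t\<bar> \<le> \<delta>/2 * exp (c * t\<^sup>2)"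
    using gauss_closureD[OF g(1) c d2] by blast
  have "\<bar>f t - N t\<bar> \<le> \<delta> * exp (c * t\<^sup>2)" for t
    using g(2)[of t] N(2)[of t] by linarith
  with N(1) show "\<exists>N. one_hidden_layer_mlp \<sigma> N \<and> (\<forall>t. \<bar>f t - N t\<bar> \<le> \<delta> * exp (c * t\<^sup>2))"
    by blast
qed

lemma gauss_closure_mlp: "one_hidden_layer_mlp \<sigma> f \<Longrightarrow> f \<in> gauss_closure \<sigma>"
  unfolding gauss_closure_def by (auto intro!: exI[of _ f])

lemma gauss_closure_activation: "\<sigma> \<in> gauss_closure \<sigma>"
  using mlp_neuron[of \<sigma> "1::real" 0 "1::real"] by (auto intro!: gauss_closure_mlp)

lemma gauss_closure_add:
  assumes "f \<in> gauss_closure \<sigma>" "g \<in> gauss_closure \<sigma>"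
  shows "(\<lambda>t. f t + g t) \<in> gauss_closure \<sigma>"
  unfolding gauss_closure_def
proof safe
  fix c \<delta> :: real assume c: "c > 0" and d: "\<delta> > 0"
  then have d2: "\<delta> / 2 > 0" by simp
  obtain M where M: "one_hidden_layer_mlp \<sigma> M" "\<And>t. \<bar>f t - M t\<bar> \<le> \<delta>/2 * exp (c * t\<^sup>2)"
    using gauss_closureD[OF assms(1) c d2] by blast
  obtain N where N: "one_hidden_layer_mlp \<sigma> N" "\<And>t. \<bar>g t - N t\<bar> \<le> \<delta>/2 * exp (c * t\<^sup>2)"
    using gauss_closureD[OF assms(2) c d2] by blast
  have "\<bar>f t + g t - (M t + N t)\<bar> \<le> \<delta> * exp (c * t\<^sup>2)" for t
    using M(2)[of t] N(2)[of t] by linarith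
  with mlp_add[OF M(1) N(1)]
  show "\<exists>N. one_hidden_layer_mlp \<sigma> N \<and> (\<forall>t. \<bar>f t + g t - N t\<bar> \<le> \<delta> * exp (c * t\<^sup>2))"
    by (intro exI[of _ "\<lambda>t. M t + N t"]) auto
qed

lemma gauss_closure_scale:
  assumes "f \<in> gauss_closure \<sigma>"
  shows "(\<lambda>t. r * f t) \<in> gauss_closure \<sigma>"
  unfolding gauss_closure_def
proof safe
  fix c \<delta> :: real assume c: "c > 0" and d: "\<delta> > 0"
  define e where "e = \<delta> / (\<bar>r\<bar> + 1)"
  have e: "e > 0" "\<bar>r\<bar> * e \<le> \<delta>" using d by (auto simp: e_def field_simps)
  obtain N where N: "one_hidden_layer_mlp \<sigma> N" "\<And>t. \<bar>f t - N t\<bar> \<le> e * exp (c * t\<^sup>2)"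
    using gauss_closureD[OF assms c e(1)] by blast
  have "\<bar>r * f t - r * N t\<bar> \<le> \<delta> * exp (c * t\<^sup>2)" for t
  proof -
    have "\<bar>r * f t - r * N t\<bar> = \<bar>r\<bar> * \<bar>f t - N t\<bar>"
      by (simp add: abs_mult flip: right_diff_distrib)
    also have "\<dots> \<le> \<bar>r\<bar> * (e * exp (c * t\<^sup>2))" using N(2) by (intro mult_left_mono) auto
    also have "\<dots> = (\<bar>r\<bar> * e) * exp (c * t\<^sup>2)" by simp
    also have "\<dots> \<le> \<delta> * exp (c * t\<^sup>2)" using e by (intro mult_right_mono) auto
    finally show ?thesis .
  qed
  moreover have "one_hidden_layer_mlp \<sigma> (\<lambda>t. r * N t)"
    by (rule mlp_linear_image[OF N(1)]) (simp add: linear_iff algebra_simps)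
  ultimately show "\<exists>N. one_hidden_layer_mlp \<sigma> N \<and> (\<forall>t. \<bar>r * f t - N t\<bar> \<le> \<delta> * exp (c * t\<^sup>2))"
    by (intro exI[of _ "\<lambda>t. r * N t"]) auto
qed

lemma gauss_closure_sum:
  assumes "\<And>i. i \<in> I \<Longrightarrow> f i \<in> gauss_closure \<sigma>"
  shows "(\<lambda>t. \<Sum>i\<in>I. f i t) \<in> gauss_closure \<sigma>"
  using assms
  by (induction I rule: infinite_finite_induct)
    (auto intro: gauss_closure_add gauss_closure_mlp[OF mlp_zero])

lemma gauss_closure_affine:
  assumes "f \<in> gauss_closure \<sigma>"
  shows "(\<lambda>t. f (w * t + b)) \<in> gauss_closure \<sigma>"
  unfolding gauss_closure_def
proof safe
  fix c \<delta> :: real assume c: "c > 0" and d: "\<delta> > 0"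
  \<comment> \<open>From \<open>(w * t + b)\<^sup>2 \<le> 2 * b\<^sup>2 + 2 * w\<^sup>2 *
    t\<^sup>2\<close>: the rate \<open>c'\<close> may grow by the factor
    \<open>2 * w\<^sup>2\<close> and still stay below \<open>c\<close>. The constant factor that
    comes from \<open>b\<close> is divided out in \<open>e\<close>.\<close>
  define c' where "c' = c / (2 * w\<^sup>2 + 1)"
  have pos: "2 * w\<^sup>2 + 1 > 0" by (intro add_nonneg_pos) auto
  then have c': "c' > 0" "2 * c' * w\<^sup>2 \<le> c"
    using c by (auto simp: c'_def field_simps)
  define e where "e = \<delta> / exp (2 * c' * b\<^sup>2)"
  have e: "e > 0" "e * exp (2 * c' * b\<^sup>2) = \<delta>" using d by (auto simp: e_def)
  obtain N where N: "one_hidden_layer_mlp \<sigma> N" "\<And>t. \<bar>f t - N t\<bar> \<le> e * exp (c' * t\<^sup>2)"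
    using gauss_closureD[OF assms c'(1) e(1)] by blast
  have "\<bar>f (w * t + b) - N (w * t + b)\<bar> \<le> \<delta> * exp (c * t\<^sup>2)" for t
  proof -
    have "(w * t + b)\<^sup>2 \<le> 2 * b\<^sup>2 + 2 * w\<^sup>2 * t\<^sup>2"
      using zero_le_power2[of "w * t - b"] by (simp add: power2_eq_square algebra_simps)
    then have "c' * (w * t + b)\<^sup>2 \<le> c' * (2 * b\<^sup>2 + 2 * w\<^sup>2 * t\<^sup>2)"
      using c' by (intro mult_left_mono) auto
    also have "\<dots> = 2 * c' * b\<^sup>2 + (2 * c' * w\<^sup>2) * t\<^sup>2" by (simp add: algebra_simps)
    also have "\<dots> \<le> 2 * c' * b\<^sup>2 + c * t\<^sup>2"
      using c' by (intro add_left_mono mult_right_mono) auto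
    finally have "exp (c' * (w * t + b)\<^sup>2) \<le> exp (2 * c' * b\<^sup>2) * exp (c * t\<^sup>2)"
      by (simp flip: exp_add)
    then have "e * exp (c' * (w * t + b)\<^sup>2) \<le> e * (exp (2 * c' * b\<^sup>2) * exp (c * t\<^sup>2))"
      using e by (intro mult_left_mono) auto
    also have "\<dots> = \<delta> * exp (c * t\<^sup>2)" using e(2) by (metis mult.assoc)
    finally show ?thesis using N(2)[of "w * t + b"] by linarith
  qed
  moreover have "one_hidden_layer_mlp \<sigma> (\<lambda>t. N (w * t + b))"
    using mlp_ridge[OF N(1), of w b] by simp
  ultimately show
    "\<exists>N. one_hidden_layer_mlp \<sigma> N \<and> (\<forall>t. \<bar>f (w * t + b) - N t\<bar> \<le> \<delta> * exp (c * t\<^sup>2))"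
    by (intro exI[of _ "\<lambda>t. N (w * t + b)"]) auto
qed

section \<open>Powers and exponentials against Gaussian weights\<close>

text \<open>One term of the exponential series, all other terms and the remainder being
  nonnegative.\<close>

lemma power_le_fact_exp:
  fixes x :: real
  assumes "0 \<le> x"
  shows "x ^ n \<le> fact n * exp x"
proof -
  obtain t where t: "exp x = (\<Sum>m<Suc n. x ^ m / fact m) + exp t / fact (Suc n) * x ^ Suc n"
    using Maclaurin_exp_le[of x "Suc n"] by blast
  have "x ^ n / fact n \<le> (\<Sum>m<Suc n. x ^ m / fact m)"
    using assms by (simp add: sum_nonneg)
  also have "\<dots> \<le> exp x" using assms unfolding t by simp
  finally show ?thesis by (simp add: field_simps)
qed

text \<open>The square of \<open>c * \<bar>x\<bar> - 1\<close> is nonnegative. This trades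
  exponential growth in \<open>\<bar>x\<bar>\<close> for a Gaussian weight of any small rate
  \<open>c\<close>, at the price of the constant \<open>exp (1 / c)\<close>.\<close>

lemma two_abs_le_square:
  fixes c x :: real
  assumes "c > 0"
  shows "2 * \<bar>x\<bar> \<le> 1 / c + c * x\<^sup>2"
proof -
  have "0 \<le> (c * \<bar>x\<bar> - 1)\<^sup>2" by simp
  then have "2 * c * \<bar>x\<bar> \<le> c\<^sup>2 * x\<^sup>2 + 1" by (simp add: power2_eq_square algebra_simps)
  then show ?thesis using assms by (simp add: field_simps power2_eq_square)
qed

lemma abs_power_le_exp_square:
  fixes c :: real
  assumes "c > 0"
  shows "\<exists>C>0. \<forall>t. \<bar>t\<bar> ^ m \<le> C * exp (c * t\<^sup>2)"
proof (intro exI conjI allI)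
  show "fact m * exp (1 / c) > (0::real)" by simp
  fix t :: real
  have "\<bar>t\<bar> \<le> 1 / c + c * t\<^sup>2" using two_abs_le_square[OF assms, of t] by linarith
  then have "exp \<bar>t\<bar> \<le> exp (1 / c) * exp (c * t\<^sup>2)" by (simp flip: exp_add)
  then have "fact m * exp \<bar>t\<bar> \<le> fact m * (exp (1 / c) * exp (c * t\<^sup>2))" by (intro mult_left_mono) auto
  then show "\<bar>t\<bar> ^ m \<le> fact m * exp (1 / c) * exp (c * t\<^sup>2)"
    using power_le_fact_exp[of "\<bar>t\<bar>" m] unfolding mult.assoc by linarith
qed

section \<open>Monomials and cosines from a Lipschitz activation\<close>

text \<open>The step is always 1; another step \<open>\<eta>\<close> is reached by rescaling the
  argument, as in \<open>non_polynomial_second_diff\<close>.\<close>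

definition fwd_diff :: "(real \<Rightarrow> real) \<Rightarrow> real \<Rightarrow> real" where
  "fwd_diff f t = f (t + 1) - f t"

lemma fwd_diff_lipschitz:
  assumes "\<And>x y. \<bar>f x - f y\<bar> \<le> L * \<bar>x - y\<bar>"
  shows "\<bar>fwd_diff f x - fwd_diff f y\<bar> \<le> (2 * L) * \<bar>x - y\<bar>"
  using assms[of "x+1" "y+1"] assms[of x y] unfolding fwd_diff_def by (simp add: algebra_simps)

lemma iter_fwd_diff_lipschitz:
  assumes "\<And>x y. \<bar>f x - f y\<bar> \<le> L * \<bar>x - y\<bar>"
  shows "\<bar>(fwd_diff ^^ k) f x - (fwd_diff ^^ k) f y\<bar> \<le> (2 ^ k * L) * \<bar>x - y\<bar>"
proof (induction k arbitrary: x y)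
  case 0
  then show ?case using assms by simp
next
  case (Suc k)
  show ?case
    using fwd_diff_lipschitz[of "(fwd_diff ^^ k) f" "2 ^ k * L" x y, OF Suc] by (simp add: mult.assoc)
qed

text \<open>One more difference over a unit step turns the Lipschitz constant of the
  \<open>k\<close>-th difference into a bound on its values.\<close>

lemma iter_fwd_diff_bounded:
  assumes "\<And>x y. \<bar>f x - f y\<bar> \<le> L * \<bar>x - y\<bar>"
  shows "\<bar>(fwd_diff ^^ Suc k) f x\<bar> \<le> 2 ^ k * L"
  using iter_fwd_diff_lipschitz[of f L k "x + 1" x, OF assms] by (simp add: fwd_diff_def)

lemma iter_fwd_diff_deriv:
  assumes "\<And>t. (f has_real_derivative f' t) (at t)"
  shows "((fwd_diff ^^ k) f has_real_derivative (fwd_diff ^^ k) f' t) (at t)"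
proof (induction k arbitrary: t)
  case 0
  then show ?case using assms by simp
next
  case (Suc k)
  have "((\<lambda>s. (fwd_diff ^^ k) f (s + 1)) has_real_derivative (fwd_diff ^^ k) f' (t + 1)) (at t)"
    using Suc[of "t + 1"] by (simp only: DERIV_shift)
  then show ?case
    using Suc[of t] unfolding fwd_diff_def funpow.simps o_def by (intro DERIV_diff)
qed

text \<open>A vanishing second difference makes the first one 1-periodic, so the function itself grows
  linearly along integer translates; boundedness then forces the first difference to vanish.\<close>

lemma iter_fwd_diff_vanish:
  assumes lip: "\<And>x y. \<bar>f x - f y\<bar> \<le> L * \<bar>x - y\<bar>"
    and "\<And>t. (fwd_diff ^^ (k + 2)) f t = 0"
  shows "(fwd_diff ^^ 2) f t = 0"
  using assms(2)
proof (induction k arbitrary: t)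
  case (Suc k)
  \<comment> \<open>The order is at least 1, which is what makes \<open>w\<close> bounded. The
    descent therefore ends at the second difference: an affine function has a constant first
    difference that may well be nonzero.\<close>
  define w where "w = (fwd_diff ^^ Suc k) f"
  have bound: "\<bar>w t\<bar> \<le> 2 ^ k * L" for t
    unfolding w_def using iter_fwd_diff_bounded[OF lip] .
  have step: "fwd_diff w (t + 1) = fwd_diff w t" for t
  proof -
    have "fwd_diff (fwd_diff w) t = 0" using Suc.prems[of t] by (simp add: w_def)
    then show ?thesis by (simp add: fwd_diff_def[of "fwd_diff w"])
  qed
  have per: "fwd_diff w (t + real n) = fwd_diff w t" for t n
  proof (induction n)
    case (Suc n)
    then show ?case using step[of "t + real n"] by (simp add: algebra_simps)
  qed simp
  have grow: "w (t + real n) = w t + real n * fwd_diff w t" for t n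
  proof (induction n)
    case (Suc n)
    have "w (t + real (Suc n)) = w (t + real n) + fwd_diff w (t + real n)"
      by (simp add: fwd_diff_def algebra_simps)
    then show ?case using Suc per by (simp add: algebra_simps)
  qed simp
  have "fwd_diff w t = 0" for t
  proof (rule ccontr)
    assume "fwd_diff w t \<noteq> 0"
    then have p: "\<bar>fwd_diff w t\<bar> > 0" by simp
    then obtain n where n: "2 * (2 ^ k * L) < real n * \<bar>fwd_diff w t\<bar>"
      using reals_Archimedean3 by blast
    have "real n * \<bar>fwd_diff w t\<bar> = \<bar>w (t + real n) - w t\<bar>"
      by (simp add: grow abs_mult)
    also have "\<dots> \<le> 2 * (2 ^ k * L)" using bound[of t] bound[of "t + real n"] by linarith
    finally show False using n by simp
  qed
  then show ?case using Suc.IH by (simp add: w_def)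
qed (simp add: numeral_2_eq_2)

text \<open>Subtracting the chord through 0 and 1 leaves a solution \<open>g\<close> of Cauchy's
  functional equation that vanishes at all integers. Being Lipschitz, \<open>g\<close> is bounded by
  its values within distance 1 of an integer, and a bounded additive function is zero.\<close>

lemma midpoint_affine_imp_affine:
  fixes f :: "real \<Rightarrow> real"
  assumes lip: "\<And>x y. \<bar>f x - f y\<bar> \<le> L * \<bar>x - y\<bar>"
    and mid: "\<And>b \<eta>. \<eta> > 0 \<Longrightarrow> f (b + 2 * \<eta>) - 2 * f (b + \<eta>) + f b = 0"
  shows "f t = f 0 + (f 1 - f 0) * t"
proof -
  define g where "g t = f t - f 0 - (f 1 - f 0) * t" for t
  have g01: "g 0 = 0" "g 1 = 0" by (auto simp: g_def)
  have mid': "g (b + 2 * \<eta>) = 2 * g (b + \<eta>) - g b" for b \<eta>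
  proof -
    \<comment> \<open>For negative \<open>\<eta>\<close> the same three points are read from the
      other end, \<open>b + 2 * \<eta>\<close>.\<close>
    consider "\<eta> > 0" | "\<eta> = 0" | "- \<eta> > 0" by linarith
    then show ?thesis
    proof cases
      case 1
      then show ?thesis using mid[OF 1, of b] by (simp add: g_def algebra_simps)
    next
      case 3
      then show ?thesis using mid[OF 3, of "b + 2 * \<eta>"] by (simp add: g_def algebra_simps)
    qed simp
  qed
  have dbl: "g (2 * x) = 2 * g x" for x using mid'[of 0 x] g01 by simp
  have add: "g (x + y) = g x + g y" for x y
    using mid'[of "2 * x" "y - x"] dbl[of x] dbl[of y] by (simp add: algebra_simps)
  have glip: "\<bar>g x - g y\<bar> \<le> (L + \<bar>f 1 - f 0\<bar>) * \<bar>x - y\<bar>" for x y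
  proof -
    have "g x - g y = (f x - f y) - (f 1 - f 0) * (x - y)" by (simp add: g_def algebra_simps)
    then have "\<bar>g x - g y\<bar> \<le> \<bar>f x - f y\<bar> + \<bar>(f 1 - f 0) * (x - y)\<bar>" by linarith
    also have "\<dots> \<le> L * \<bar>x - y\<bar> + \<bar>f 1 - f 0\<bar> * \<bar>x - y\<bar>"
      using lip by (intro add_mono) (auto simp: abs_mult)
    finally show ?thesis by (simp add: algebra_simps)
  qed
  have int: "g (of_int n) = 0" for n
  proof -
    have nat: "g (real m) = 0" for m
      by (induction m) (auto simp: g01 add add.commute)
    have "g (- real m) = 0" for m using add[of "real m" "- real m"] nat g01 by simp
    with nat show ?thesis by (cases n rule: int_cases2) auto
  qed
  define C where "C = L + \<bar>f 1 - f 0\<bar>"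
  have C: "C \<ge> 0" using glip[of 1 0] by (simp add: C_def)
  have bd: "\<bar>g x\<bar> \<le> C" for x
  proof -
    have "\<bar>g x - g (of_int \<lfloor>x\<rfloor>)\<bar> \<le> C * \<bar>x - of_int \<lfloor>x\<rfloor>\<bar>" unfolding C_def by (rule glip)
    also have "\<dots> \<le> C * 1"
    proof (intro mult_left_mono C)
      show "\<bar>x - of_int \<lfloor>x\<rfloor>\<bar> \<le> 1" by linarith
    qed
    finally show ?thesis using int by simp
  qed
  have mult: "g (real n * x) = real n * g x" for n x
    by (induction n) (auto simp: g01 add algebra_simps)
  have "g t = 0"
  proof (rule ccontr)
    assume "g t \<noteq> 0"
    then have "\<bar>g t\<bar> > 0" by simp
    then obtain n where "C < real n * \<bar>g t\<bar>" using reals_Archimedean3 by blast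
    then have "C < \<bar>g (real n * t)\<bar>" by (simp add: mult abs_mult)
    then show False using bd[of "real n * t"] by simp
  qed
  then show ?thesis by (simp add: g_def)
qed

text \<open>If all second differences of all steps vanished, \<open>\<sigma>\<close> would be affine
  and thus a polynomial. Rescaling by the step \<open>\<eta>\<close> of a nonzero one makes it a
  difference of unit step.\<close>

lemma non_polynomial_second_diff:
  assumes lip: "\<And>x y. \<bar>\<sigma> x - \<sigma> y\<bar> \<le> L * \<bar>x - y\<bar>" and "non_polynomial \<sigma>"
  obtains \<eta> b where "\<eta> > 0" "(fwd_diff ^^ 2) (\<lambda>t. \<sigma> (\<eta> * t)) b \<noteq> 0"
proof -
  have "\<exists>b \<eta>. \<eta> > 0 \<and> \<sigma> (b + 2 * \<eta>) - 2 * \<sigma> (b + \<eta>) + \<sigma> b \<noteq> 0"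
  proof (rule ccontr)
    assume "\<not> ?thesis"
    then have "\<sigma> t = \<sigma> 0 + (\<sigma> 1 - \<sigma> 0) * t" for t
      using midpoint_affine_imp_affine[of \<sigma> L, OF lip] by blast
    then have "\<sigma> t = poly [:\<sigma> 0, \<sigma> 1 - \<sigma> 0:] t" for t
      by (metis mult.commute poly_0 poly_pCons add.right_neutral mult_zero_right)
    with assms(2) show False unfolding non_polynomial_def by blast
  qed
  then obtain b \<eta> where *: "\<eta> > 0" "\<sigma> (b + 2 * \<eta>) - 2 * \<sigma> (b + \<eta>) + \<sigma> b \<noteq> 0" by blast
  have "(fwd_diff ^^ 2) (\<lambda>t. \<sigma> (\<eta> * t)) (b / \<eta>) = \<sigma> (b + 2 * \<eta>) - 2 * \<sigma> (b + \<eta>) + \<sigma> b"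
  proof -
    have "\<eta> * (b / \<eta>) = b" "\<eta> * (b / \<eta> + 1) = b + \<eta>" "\<eta> * (b / \<eta> + 1 + 1) = b + 2 * \<eta>"
      using *(1) by (auto simp: field_simps)
    then show ?thesis by (simp add: numeral_2_eq_2 fwd_diff_def)
  qed
  with * show ?thesis by (intro that[of \<eta> "b / \<eta>"]) auto
qed

section \<open>Moving averages and their Taylor expansion\<close>

text \<open>Serves to write a moving average as a difference of two values of an antiderivative, so
  that its Riemann sums can be estimated by the mean value theorem alone.\<close>

lemma real_antiderivative_exists:
  fixes f :: "real \<Rightarrow> real"
  assumes "continuous_on UNIV f"
  obtains A where "\<And>t. (A has_real_derivative f t) (at t)"
proof -
  have "\<exists>A. \<forall>x::real. -\<infinity> < ereal x \<longrightarrow> ereal x < \<infinity> \<longrightarrow> (A has_vector_derivative f x) (at x)"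
    using assms by (intro einterval_antiderivative) (auto simp: continuous_on_eq_continuous_at)
  then show ?thesis using that by (auto simp: has_real_derivative_iff_has_vector_derivative)
qed

text \<open>\<open>F\<close> is the moving average \<open>t \<mapsto> \<integral> f\<close> over \<open>{t..t+1}\<close>; it stays in the closure because its
  Riemann sums converge uniformly on the whole line when \<open>f\<close> is Lipschitz.\<close>

lemma gauss_closure_moving_average:
  assumes f: "f \<in> gauss_closure \<sigma>" and lip: "\<And>x y. \<bar>f x - f y\<bar> \<le> L * \<bar>x - y\<bar>"
  shows "\<exists>F. F \<in> gauss_closure \<sigma> \<and> (\<forall>x y. \<bar>F x - F y\<bar> \<le> L * \<bar>x - y\<bar>) \<and>
           (\<forall>t. (F has_real_derivative fwd_diff f t) (at t))"
proof -
  have L: "L \<ge> 0" using lip[of 1 0] by simp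
  have "continuous_on UNIV f"
    by (rule lipschitz_on_continuous_on[of L]) (use lip L in \<open>auto simp: lipschitz_on_def dist_real_def\<close>)
  then obtain A where A: "\<And>t. (A has_real_derivative f t) (at t)"
    using real_antiderivative_exists by blast
  define F where "F t = A (t + 1) - A t" for t
  have F': "(F has_real_derivative fwd_diff f t) (at t)" for t
  proof -
    have "((\<lambda>s. A (s + 1)) has_real_derivative f (t + 1)) (at t)"
      using A[of "t + 1"] by (simp only: DERIV_shift)
    then show ?thesis unfolding F_def fwd_diff_def using A by (intro DERIV_diff)
  qed
  \<comment> \<open>The derivative \<open>fwd_diff f\<close> is bounded by \<open>L\<close>, so
    averaging keeps the very same constant and can be iterated.\<close>
  have lip_less: "\<bar>F x - F y\<bar> \<le> L * \<bar>x - y\<bar>" if xy: "x < y" for x y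
  proof -
    obtain z where "F y - F x = (y - x) * fwd_diff f z"
      using MVT2[OF xy, of F "fwd_diff f"] F' by blast
    moreover have "\<bar>fwd_diff f z\<bar> \<le> L" using lip[of "z + 1" z] by (simp add: fwd_diff_def)
    ultimately show ?thesis
      using xy mult_left_mono[of "\<bar>fwd_diff f z\<bar>" L "y - x"]
      by (simp add: abs_minus_commute[of "F x"] abs_mult abs_minus_commute[of x] mult.commute)
  qed
  have Flip: "\<bar>F x - F y\<bar> \<le> L * \<bar>x - y\<bar>" for x y
    using lip_less[of x y] lip_less[of y x] by (cases x y rule: linorder_cases) (auto simp: abs_minus_commute)
  have "F \<in> gauss_closure \<sigma>"
  proof (rule gauss_closure_limit)
    fix c \<delta> :: real assume c: "c > 0" and d: "\<delta> > 0"
    obtain n where n: "L / \<delta> < real n" using reals_Archimedean2 by blast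
    have n0: "n > 0" using n L d by (cases n) (auto simp: field_simps)
    have Ln: "L / real n \<le> \<delta>" using n d n0 by (simp add: field_simps)
    \<comment> \<open>The left Riemann sum: each of its \<open>n\<close> cells errs by at most
      \<open>L / (real n)\<^sup>2\<close>. The form \<open>1 * t\<close> makes the summands
      instances of \<open>gauss_closure_affine\<close>.\<close>
    define G where "G t = (\<Sum>i<n. (1 / real n) * f (1 * t + real i / real n))" for t
    have "G \<in> gauss_closure \<sigma>"
      unfolding G_def by (intro gauss_closure_sum gauss_closure_scale gauss_closure_affine f)
    moreover have "\<bar>F t - G t\<bar> \<le> \<delta> * exp (c * t\<^sup>2)" for t
    proof -
      define p where "p i = t + real i / real n" for i
      have piece: "\<bar>(A (p (Suc i)) - A (p i)) - (1 / real n) * f (p i)\<bar> \<le> L / (real n)\<^sup>2" for i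
      proof -
        have lt: "p i < p (Suc i)" and df: "p (Suc i) - p i = 1 / real n"
          using n0 by (auto simp: p_def field_simps)
        obtain z where z: "p i < z" "z < p (Suc i)" "A (p (Suc i)) - A (p i) = (p (Suc i) - p i) * f z"
          using MVT2[OF lt, of A f] A by blast
        have "\<bar>(A (p (Suc i)) - A (p i)) - (1 / real n) * f (p i)\<bar> = (1 / real n) * \<bar>f z - f (p i)\<bar>"
          unfolding z(3) df by (simp add: abs_mult diff_divide_distrib[symmetric])
        also have "\<dots> \<le> (1 / real n) * (L * (1 / real n))"
        proof (intro mult_left_mono)
          have "\<bar>f z - f (p i)\<bar> \<le> L * \<bar>z - p i\<bar>" using lip .
          also have "\<dots> \<le> L * (1 / real n)" using z df L by (intro mult_left_mono) auto
          finally show "\<bar>f z - f (p i)\<bar> \<le> L * (1 / real n)" .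
        qed simp
        finally show ?thesis by (simp add: power2_eq_square)
      qed
      have "F t = (\<Sum>i<n. A (p (Suc i)) - A (p i))"
        using sum_lessThan_telescope[of "\<lambda>i. A (p i)" n] n0 unfolding F_def by (simp add: p_def[of n] p_def[of 0])
      then have "F t - G t = (\<Sum>i<n. (A (p (Suc i)) - A (p i)) - (1 / real n) * f (p i))"
        unfolding G_def sum_subtractf by (simp add: p_def)
      also have "\<bar>\<dots>\<bar> \<le> (\<Sum>i<n. L / (real n)\<^sup>2)"
        using piece by (intro order_trans[OF sum_abs] sum_mono)
      also have "\<dots> = L / real n" using n0 by (simp add: power2_eq_square)
      also have "\<dots> \<le> \<delta> * 1" using Ln by simp
      also have "\<dots> \<le> \<delta> * exp (c * t\<^sup>2)" using c d by (intro mult_left_mono) auto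
      finally show ?thesis .
    qed
    ultimately show "\<exists>g\<in>gauss_closure \<sigma>. \<forall>t. \<bar>F t - g t\<bar> \<le> \<delta> * exp (c * t\<^sup>2)" by blast
  qed
  then show ?thesis using Flip F' by blast
qed

text \<open>Averaging preserves both membership in the closure and the constant \<open>L\<close>;
  this invariant \<open>P\<close> carries the recursion.\<close>

lemma moving_average_sequence:
  assumes "s \<in> gauss_closure \<sigma>" and "\<And>x y. \<bar>s x - s y\<bar> \<le> L * \<bar>x - y\<bar>"
  obtains F where "F 0 = s" "\<And>n::nat. F n \<in> gauss_closure \<sigma>"
    "\<And>n t. (F (Suc n) has_real_derivative fwd_diff (F n) t) (at t)"
proof -
  define P where "P f \<longleftrightarrow> f \<in> gauss_closure \<sigma> \<and> (\<forall>x y. \<bar>f x - f y\<bar> \<le> L * \<bar>x - y\<bar>)"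
    for f :: "real \<Rightarrow> real"
  have "\<exists>F. (F 0 = s \<and> P (F 0)) \<and> (\<forall>n. P (F (Suc n)) \<and>
          (\<forall>t. (F (Suc n) has_real_derivative fwd_diff (F n) t) (at t)))"
  proof -
    define step where "step f = (SOME g. P g \<and> (\<forall>t. (g has_real_derivative fwd_diff f t) (at t)))" for f
    have step: "P (step f) \<and> (\<forall>t. (step f has_real_derivative fwd_diff f t) (at t))" if "P f" for f
    proof -
      have "\<exists>g. P g \<and> (\<forall>t. (g has_real_derivative fwd_diff f t) (at t))"
        using gauss_closure_moving_average[of f \<sigma> L] that unfolding P_def by blast
      then show ?thesis unfolding step_def by (rule someI_ex)
    qed
    have "P s" using assms by (simp add: P_def)
    then have "P ((step ^^ n) s)" for n by (induction n) (auto dest: step)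
    with step \<open>P s\<close> show ?thesis by (intro exI[of _ "\<lambda>n. (step ^^ n) s"]) auto
  qed
  then obtain F where F: "F 0 = s" "P (F 0)" "\<And>n. P (F (Suc n))"
    "\<And>n t. (F (Suc n) has_real_derivative fwd_diff (F n) t) (at t)" by blast
  have "F n \<in> gauss_closure \<sigma>" for n using F(2,3) by (cases n) (auto simp: P_def)
  with F that show ?thesis by blast
qed

text \<open>The \<open>k\<close>-fold moving average \<open>F k\<close> of \<open>s\<close> has \<open>k\<close>-th derivative \<open>(fwd_diff ^^ k) s\<close>, which is Lipschitz and
  nonzero at some \<open>b\<close>. Expanding \<open>F k (w * t + b)\<close> in powers of \<open>w\<close>, removing the terms of order below
  \<open>k\<close> (by induction) and dividing by \<open>w ^ k\<close> isolates \<open>t ^ k\<close> as \<open>w \<rightarrow> 0\<close>.\<close>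

lemma gauss_closure_monomial:
  assumes s: "s \<in> gauss_closure \<sigma>" and lip: "\<And>x y. \<bar>s x - s y\<bar> \<le> L * \<bar>x - y\<bar>"
    and nz: "\<And>k. \<exists>b. (fwd_diff ^^ k) s b \<noteq> 0"
  shows "(\<lambda>t. t ^ k) \<in> gauss_closure \<sigma>"
proof (induction k rule: less_induct)
  case (less k)
  obtain F where F: "F 0 = s" "\<And>n::nat. F n \<in> gauss_closure \<sigma>"
    "\<And>n t. (F (Suc n) has_real_derivative fwd_diff (F n) t) (at t)"
    using moving_average_sequence[OF s lip] by blast
  \<comment> \<open>\<open>D m\<close> is the \<open>m\<close>-th derivative of \<open>F k\<close>:
    each differentiation trades one moving average for one forward difference, until none is left at
    \<open>m = k\<close>.\<close>
  define D where "D m = (fwd_diff ^^ m) (F (k - m))" for m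
  have D': "(D m has_real_derivative D (Suc m) t) (at t)" if mk: "m < k" for m t
  proof -
    obtain j where j: "k - m = Suc j" "k - Suc m = j" using mk by (cases "k - m") auto
    have "((fwd_diff ^^ m) (F (Suc j)) has_real_derivative (fwd_diff ^^ m) (fwd_diff (F j)) t) (at t)"
      by (rule iter_fwd_diff_deriv) (rule F(3))
    then show ?thesis unfolding D_def j by (simp add: funpow_swap1)
  qed
  have Dk: "D k = (fwd_diff ^^ k) s" by (simp add: D_def F(1))
  define M where "M = 2 ^ k * L"
  have Mlip: "\<bar>D k x - D k y\<bar> \<le> M * \<bar>x - y\<bar>" for x y
    unfolding Dk M_def by (rule iter_fwd_diff_lipschitz[OF lip])
  have M: "M \<ge> 0" using Mlip[of 1 0] by simp
  obtain b where b: "D k b \<noteq> 0" using nz[of k] by (auto simp: Dk)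
  have taylor: "\<bar>F k (b + x) - (\<Sum>m<k. D m b / fact m * x ^ m) - D k b / fact k * x ^ k\<bar>
                  \<le> M * \<bar>x\<bar> ^ Suc k" for x
  \<comment> \<open>Taylor's theorem asks for a positive order and a point apart from the centre, so
    the degenerate cases are settled directly.\<close>
  proof (cases "k = 0 \<or> x = 0")
    case True
    show ?thesis
    proof (cases "k = 0")
      case True
      then show ?thesis using Mlip[of "b + x" b] by (simp add: D_def)
    next
      case False
      then obtain j where "k = Suc j" by (cases k) auto
      moreover have "x = 0" using False \<open>k = 0 \<or> x = 0\<close> by simp
      ultimately show ?thesis by (simp add: D_def sum.lessThan_Suc_shift)
    qed
  next
    case False
    have "\<exists>t. (if b + x < b then b + x < t \<and> t < b else b < t \<and> t < b + x) \<and>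
      F k (b + x) = (\<Sum>m<k. (D m b / fact m) * (b + x - b)^m) + (D k t / fact k) * (b + x - b)^k"
      by (rule Taylor[where a = "b - \<bar>x\<bar>" and b = "b + \<bar>x\<bar>"])
        (use False D' in \<open>auto simp: D_def[of 0]\<close>)
    then obtain t where "if b + x < b then b + x < t \<and> t < b else b < t \<and> t < b + x"
      and t2: "F k (b + x) = (\<Sum>m<k. D m b / fact m * x ^ m) + D k t / fact k * x ^ k"
      by auto
    then have t1: "\<bar>t - b\<bar> \<le> \<bar>x\<bar>" by (auto split: if_splits)
    have "F k (b + x) - (\<Sum>m<k. D m b / fact m * x ^ m) - D k b / fact k * x ^ k
            = (D k t - D k b) * (x ^ k / fact k)"
      by (simp add: t2 algebra_simps)
    also have "\<bar>\<dots>\<bar> = \<bar>D k t - D k b\<bar> * (\<bar>x\<bar> ^ k / fact k)" by (simp add: abs_mult power_abs)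
    also have "\<dots> \<le> (M * \<bar>x\<bar>) * (\<bar>x\<bar> ^ k)"
    proof (intro mult_mono)
      show "\<bar>D k t - D k b\<bar> \<le> M * \<bar>x\<bar>"
        using Mlip[of t b] mult_left_mono[OF t1 M] by linarith
      show "\<bar>x\<bar> ^ k / fact k \<le> \<bar>x\<bar> ^ k"
        using mult_left_mono[OF fact_ge_1[of k, where 'a = real], of "\<bar>x\<bar> ^ k"]
        by (simp add: field_simps)
    qed (use M in auto)
    finally show ?thesis by (simp add: mult.assoc)
  qed
  show ?case
  proof (rule gauss_closure_limit)
    fix c \<delta> :: real assume c: "c > 0" and d: "\<delta> > 0"
    obtain C where C: "C > 0" "\<And>t. \<bar>t\<bar> ^ Suc k \<le> C * exp (c * t\<^sup>2)"
      using abs_power_le_exp_square[OF c, of "Suc k"] by blast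
    \<comment> \<open>This normalises the coefficient of \<open>t ^ k\<close> to 1.\<close>
    define a where "a = fact k / D k b"
    have a: "a \<noteq> 0" "a * (D k b / fact k) = 1" using b by (auto simp: a_def)
    \<comment> \<open>After division by \<open>w ^ k\<close> the Taylor remainder is at most
      \<open>w * \<bar>a\<bar> * M * \<bar>t\<bar> ^ Suc k\<close>, and \<open>C\<close> turns the
      power of \<open>t\<close> into the weight. The summand 1 keeps the denominator
      positive.\<close>
    define w where "w = \<delta> / (\<bar>a\<bar> * M * C + 1)"
    have den: "\<bar>a\<bar> * M * C + 1 > 0" using M C by (intro add_nonneg_pos mult_nonneg_nonneg) auto
    have w: "w > 0" using d den by (simp add: w_def)
    have "w * (\<bar>a\<bar> * M * C) \<le> w * (\<bar>a\<bar> * M * C + 1)" using w by (intro mult_left_mono) auto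
    also have "\<dots> = \<delta>" using den by (simp add: w_def)
    finally have wd: "w * (\<bar>a\<bar> * M * C) \<le> \<delta>" .
    define g where "g t = (a / w ^ k) * F k (w * t + b)
        + (\<Sum>m<k. (- (a / w ^ k) * (D m b / fact m) * w ^ m) * t ^ m)" for t
    have "g \<in> gauss_closure \<sigma>"
      unfolding g_def using less F(2)
      by (intro gauss_closure_add gauss_closure_scale gauss_closure_sum gauss_closure_affine) auto
    moreover have "\<bar>t ^ k - g t\<bar> \<le> \<delta> * exp (c * t\<^sup>2)" for t
    proof -
      have gt: "g t = (a / w ^ k) * (F k (b + w * t) - (\<Sum>m<k. D m b / fact m * (w * t) ^ m))"
        by (simp add: g_def algebra_simps sum_distrib_left power_mult_distrib sum_negf)
      have tk: "t ^ k = (a / w ^ k) * (D k b / fact k * (w * t) ^ k)"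
        using w a b by (simp add: power_mult_distrib)
      have "\<bar>t ^ k - g t\<bar> = \<bar>g t - t ^ k\<bar>" by simp
      also have "\<dots> = \<bar>a / w ^ k\<bar> *
          \<bar>F k (b + w * t) - (\<Sum>m<k. D m b / fact m * (w * t) ^ m) - D k b / fact k * (w * t) ^ k\<bar>"
        unfolding gt by (subst tk) (simp only: abs_mult flip: right_diff_distrib)
      also have "\<dots> \<le> \<bar>a / w ^ k\<bar> * (M * \<bar>w * t\<bar> ^ Suc k)"
        by (intro mult_left_mono taylor) simp
      also have "\<dots> = (w * (\<bar>a\<bar> * M)) * \<bar>t\<bar> ^ Suc k"
        using w by (simp add: abs_mult power_mult_distrib)
      also have "\<dots> \<le> (w * (\<bar>a\<bar> * M)) * (C * exp (c * t\<^sup>2))"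
        using C w M by (intro mult_left_mono) auto
      also have "\<dots> = (w * (\<bar>a\<bar> * M * C)) * exp (c * t\<^sup>2)" by simp
      also have "\<dots> \<le> \<delta> * exp (c * t\<^sup>2)" using wd by (intro mult_right_mono) auto
      finally show ?thesis .
    qed
    ultimately show "\<exists>g\<in>gauss_closure \<sigma>. \<forall>t. \<bar>t ^ k - g t\<bar> \<le> \<delta> * exp (c * t\<^sup>2)" by blast
  qed
qed

text \<open>The Taylor remainder is at most \<open>\<bar>x\<bar> ^ n / fact n\<close>, hence at most
  \<open>exp (2 * \<bar>x\<bar>) / 2 ^ n\<close>: doubling the argument of the exponential gains a
  geometric factor, and the weight absorbs \<open>exp (2 * \<bar>x\<bar>)\<close>.\<close>

lemma gauss_closure_cos:
  assumes mono: "\<And>k. (\<lambda>t. t ^ k) \<in> gauss_closure \<sigma>"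
  shows "(\<lambda>t. cos (a * t + b)) \<in> gauss_closure \<sigma>"
proof -
  have "cos \<in> gauss_closure \<sigma>"
  proof (rule gauss_closure_limit)
    fix c \<delta> :: real assume c: "c > 0" and d: "\<delta> > 0"
    obtain n where n: "exp (1 / c) / \<delta> < 2 ^ n" using real_arch_pow[of 2] by auto
    define g where "g x = (\<Sum>m<n. cos_coeff m * x ^ m)" for x :: real
    have "g \<in> gauss_closure \<sigma>"
      unfolding g_def using mono by (intro gauss_closure_sum gauss_closure_scale) auto
    moreover have "\<bar>cos x - g x\<bar> \<le> \<delta> * exp (c * x\<^sup>2)" for x
    proof -
      obtain t where t: "cos x = g x + cos (t + 1/2 * real n * pi) / fact n * x ^ n"
        using Maclaurin_cos_expansion[of x n] unfolding g_def by blast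
      have "\<bar>cos x - g x\<bar> = \<bar>cos (t + 1/2 * real n * pi)\<bar> * (\<bar>x\<bar> ^ n / fact n)"
        by (simp add: t abs_mult power_abs)
      also have "\<dots> \<le> 1 * (\<bar>x\<bar> ^ n / fact n)" by (intro mult_right_mono) auto
      also have "\<dots> \<le> exp (2 * \<bar>x\<bar>) / 2 ^ n"
        using power_le_fact_exp[of "2 * \<bar>x\<bar>" n] by (simp add: field_simps)
      also have "\<dots> \<le> exp (1 / c + c * x\<^sup>2) / 2 ^ n"
        using two_abs_le_square[OF c, of x] by (intro divide_right_mono) auto
      also have "\<dots> = exp (1 / c) / 2 ^ n * exp (c * x\<^sup>2)" by (simp add: exp_add)
      also have "\<dots> \<le> \<delta> * exp (c * x\<^sup>2)"
        using n d by (intro mult_right_mono) (auto simp: field_simps)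
      finally show ?thesis .
    qed
    ultimately show "\<exists>g\<in>gauss_closure \<sigma>. \<forall>t. \<bar>cos t - g t\<bar> \<le> \<delta> * exp (c * t\<^sup>2)" by blast
  qed
  then show ?thesis by (rule gauss_closure_affine)
qed

text \<open>A rescaled copy \<open>s\<close> of \<open>\<sigma>\<close> has a nonzero second
  difference, and by \<open>iter_fwd_diff_vanish\<close> no iterated difference of \<open>s\<close>
  can then vanish identically. This is the condition for all monomials.\<close>

lemma gauss_closure_cos_lipschitz:
  assumes "lipschitz \<sigma>" "non_polynomial \<sigma>"
  shows "(\<lambda>t. cos (a * t + b)) \<in> gauss_closure \<sigma>"
proof -
  obtain L where "L-lipschitz_on UNIV \<sigma>" using assms(1) unfolding lipschitz_def by blast
  then have L: "\<bar>\<sigma> x - \<sigma> y\<bar> \<le> L * \<bar>x - y\<bar>" for x y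
    unfolding lipschitz_on_def by (simp add: dist_real_def)
  obtain \<eta> c where \<eta>: "\<eta> > 0" "(fwd_diff ^^ 2) (\<lambda>t. \<sigma> (\<eta> * t)) c \<noteq> 0"
    using non_polynomial_second_diff[OF L assms(2)] .
  define s where "s t = \<sigma> (\<eta> * t)" for t
  have slip: "\<bar>s x - s y\<bar> \<le> (L * \<eta>) * \<bar>x - y\<bar>" for x y
    using L[of "\<eta> * x" "\<eta> * y"] \<eta>(1) by (simp add: s_def abs_mult flip: right_diff_distrib)
  have "s \<in> gauss_closure \<sigma>"
    using gauss_closure_affine[OF gauss_closure_activation, where w = \<eta> and b = 0] by (simp add: s_def[abs_def])
  moreover have "\<exists>b. (fwd_diff ^^ k) s b \<noteq> 0" for k
  proof (rule ccontr)
    assume "\<not> ?thesis"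
    then have "(fwd_diff ^^ k) s = (\<lambda>t. 0)" by auto
    \<comment> \<open>Two further differences bring the order to at least 2, which includes the
      cases \<open>k = 0\<close> and \<open>k = 1\<close>.\<close>
    then have "(fwd_diff ^^ (k + 2)) s t = 0" for t
      by (simp add: fwd_diff_def)
    from iter_fwd_diff_vanish[OF slip this, of c] \<eta>(2) show False by (simp add: s_def[abs_def])
  qed
  ultimately show ?thesis using slip by (intro gauss_closure_cos gauss_closure_monomial)
qed

section \<open>Universal approximation by trigonometric sums\<close>

text \<open>Free phases \<open>b\<close> make sines and constants special cosines. Only linear
  combinations of ridge functions are generated, which networks can imitate term by term; closure
  under products is a consequence of the product-to-sum formula.\<close>

inductive_set trig_sums :: "('a::real_inner \<Rightarrow> real) set" where
  cos: "(\<lambda>x. cos (a \<bullet> x + b)) \<in> trig_sums"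
| add: "f \<in> trig_sums \<Longrightarrow> g \<in> trig_sums \<Longrightarrow> (\<lambda>x. f x + g x) \<in> trig_sums"
| scale: "f \<in> trig_sums \<Longrightarrow> (\<lambda>x. r * f x) \<in> trig_sums"

lemma trig_sums_const: "(\<lambda>x. r) \<in> trig_sums"
  using trig_sums.scale[OF trig_sums.cos[of 0 0], of r] by simp

lemma trig_sums_cos_mult:
  assumes "g \<in> trig_sums"
  shows "(\<lambda>x. cos (a \<bullet> x + b) * g x) \<in> trig_sums"
  using assms
proof induction
  case (cos a' b')
  have "cos (a \<bullet> x + b) * cos (a' \<bullet> x + b') =
      1/2 * cos ((a - a') \<bullet> x + (b - b')) + 1/2 * cos ((a + a') \<bullet> x + (b + b'))" for x
    unfolding cos_times_cos by (simp add: algebra_simps add_divide_distrib)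
  then show ?case by (simp only:) (rule trig_sums.add; rule trig_sums.scale; rule trig_sums.cos)
next
  case (add f g)
  then show ?case by (simp only: distrib_left) (rule trig_sums.add)
next
  case (scale f r)
  have "cos (a \<bullet> x + b) * (r * f x) = r * (cos (a \<bullet> x + b) * f x)" for x by simp
  with trig_sums.scale[OF scale.IH, of r] show ?case by (simp only:)
qed

lemma trig_sums_mult:
  assumes "f \<in> trig_sums" "g \<in> trig_sums"
  shows "(\<lambda>x. f x * g x) \<in> trig_sums"
  using assms(1)
proof induction
  case (cos a b)
  show ?case by (rule trig_sums_cos_mult[OF assms(2)])
next
  case (add f1 f2)
  then show ?case by (simp only: distrib_right) (rule trig_sums.add)
next
  case (scale f r)
  then show ?case by (simp only: mult.assoc) (rule trig_sums.scale)
qed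

lemma trig_sums_power: "f \<in> trig_sums \<Longrightarrow> (\<lambda>x. f x ^ n) \<in> trig_sums"
  by (induction n) (auto intro: trig_sums_const trig_sums_mult)

lemma trig_sums_sum:
  assumes "\<And>i. i \<in> I \<Longrightarrow> f i \<in> trig_sums"
  shows "(\<lambda>x. \<Sum>i\<in>I. f i x) \<in> trig_sums"
  using assms
  by (induction I rule: infinite_finite_induct) (auto intro: trig_sums_const trig_sums.add)

lemma trig_sums_continuous:
  assumes "f \<in> trig_sums"
  shows "continuous_on S f"
  using assms by induction (auto intro!: continuous_intros)

lemma trig_sums_gauss_closure:
  fixes f :: "real \<Rightarrow> real"
  assumes "f \<in> trig_sums" "lipschitz \<sigma>" "non_polynomial \<sigma>"
  shows "f \<in> gauss_closure \<sigma>"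
  using assms(1)
proof induction
  case (cos a b)
  show ?case using gauss_closure_cos_lipschitz[OF assms(2,3), of a b] by simp
qed (auto intro: gauss_closure_add gauss_closure_scale)

text \<open>Substituting \<open>sin (\<beta> * t)\<close> into a Weierstrass polynomial keeps the approximant bounded by
  about \<open>B\<close> on the whole line, while on the large interval \<open>{-P..P}\<close>, where the sine is injective,
  it is close to \<open>f\<close>; outside, the Gaussian weight absorbs the error.\<close>

lemma bounded_continuous_gauss_closure:
  fixes f :: "real \<Rightarrow> real"
  assumes f: "continuous_on UNIV f" and B: "\<And>t. \<bar>f t\<bar> \<le> B"
    and \<sigma>: "lipschitz \<sigma>" "non_polynomial \<sigma>"
  shows "f \<in> gauss_closure \<sigma>"
proof (rule gauss_closure_limit)
  fix c \<delta> :: real assume c: "c > 0" and d: "\<delta> > 0"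
  have B0: "B \<ge> 0" using B[of 0] by linarith
  \<comment> \<open>Chosen so that beyond \<open>P\<close> the quantity
    \<open>\<delta> * (1 + c * t\<^sup>2)\<close>, a lower bound of the weighted tolerance, exceeds
    the crude error bound \<open>2 * B + \<delta>\<close>.\<close>
  define P where "P = sqrt ((2 * B + 1) / (c * \<delta>))"
  have P: "P > 0" and P2: "c * P\<^sup>2 = (2 * B + 1) / \<delta>"
    using c d B0 by (auto simp: P_def)
  \<comment> \<open>The factor \<open>\<beta>\<close> maps \<open>{-P..P}\<close> onto the interval
    from \<open>- pi / 2\<close> to \<open>pi / 2\<close>, where \<open>arcsin\<close> inverts the
    sine; \<open>G\<close> is \<open>f\<close> in the variable
    \<open>sin (\<beta> * t)\<close>.\<close>
  define \<beta> where "\<beta> = pi / (2 * P)"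
  have \<beta>: "\<beta> > 0" "\<beta> * P = pi / 2" using P by (auto simp: \<beta>_def)
  define G where "G s = f (arcsin s / \<beta>)" for s
  have "continuous_on {-1..1} G"
    unfolding G_def
    by (rule continuous_on_compose2[OF f]) (use \<beta> in \<open>auto intro!: continuous_intros\<close>)
  then obtain p where p: "real_polynomial_function p" "\<And>s. s \<in> {-1..1} \<Longrightarrow> \<bar>G s - p s\<bar> < \<delta>"
    using Stone_Weierstrass_real_polynomial_function[of "{-1..1}" G \<delta>] d by auto
  obtain a n where pa: "p = (\<lambda>x. \<Sum>i\<le>n. a i * x ^ i)"
    using p(1) unfolding real_polynomial_function_iff_sum by blast
  define q where "q t = p (sin (\<beta> * t))" for t
  have "(\<lambda>t. sin (\<beta> * t)) \<in> trig_sums"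
    using trig_sums.cos[of \<beta> "- (pi / 2)"] by (simp add: cos_diff)
  then have "q \<in> trig_sums"
    unfolding q_def pa by (intro trig_sums_sum trig_sums.scale trig_sums_power)
  then have "q \<in> gauss_closure \<sigma>" using \<sigma> by (rule trig_sums_gauss_closure)
  moreover have "\<bar>f t - q t\<bar> \<le> \<delta> * exp (c * t\<^sup>2)" for t
  proof (cases "\<bar>t\<bar> \<le> P")
    case True
    then have "\<beta> * \<bar>t\<bar> \<le> pi / 2" using \<beta> by (metis mult_left_mono less_imp_le)
    then have "\<bar>\<beta> * t\<bar> \<le> pi / 2" using \<beta>(1) by (simp add: abs_mult)
    then have "arcsin (sin (\<beta> * t)) = \<beta> * t" by (intro arcsin_sin) linarith+
    then have "G (sin (\<beta> * t)) = f t" using \<beta> by (simp add: G_def)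
    then have "\<bar>f t - q t\<bar> \<le> \<delta>" using p(2)[of "sin (\<beta> * t)"] by (simp add: q_def)
    also have "\<dots> \<le> \<delta> * exp (c * t\<^sup>2)" using c d by simp
    finally show ?thesis .
  next
    case False
    have "\<bar>G (sin (\<beta> * t))\<bar> \<le> B" using B by (simp add: G_def)
    then have "\<bar>f t - q t\<bar> \<le> 2 * B + \<delta>"
      using p(2)[of "sin (\<beta> * t)"] B[of t] by (auto simp: q_def)
    also have "\<dots> \<le> \<delta> * (1 + c * P\<^sup>2)" unfolding P2 using d by (simp add: field_simps)
    also have "\<dots> \<le> \<delta> * (1 + c * t\<^sup>2)"
    proof -
      have "P\<^sup>2 \<le> t\<^sup>2" using False P power_mono[of P "\<bar>t\<bar>" 2] by simp
      then show ?thesis using c d by simp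
    qed
    also have "\<dots> \<le> \<delta> * exp (c * t\<^sup>2)" using d by (intro mult_left_mono exp_ge_add_one_self) auto
    finally show ?thesis .
  qed
  ultimately show "\<exists>g\<in>gauss_closure \<sigma>. \<forall>t. \<bar>f t - g t\<bar> \<le> \<delta> * exp (c * t\<^sup>2)" by blast
qed

lemma bounded_continuous_vector_mlp:
  fixes f :: "real \<Rightarrow> 'b::euclidean_space"
  assumes f: "continuous_on UNIV f" and B: "\<And>t. norm (f t) \<le> B"
    and \<sigma>: "lipschitz \<sigma>" "non_polynomial \<sigma>" and c: "c > 0" and d: "\<delta> > 0"
  obtains N where "one_hidden_layer_mlp \<sigma> N" "\<And>t. norm (f t - N t) \<le> \<delta> * exp (c * t\<^sup>2)"
proof -
  define e where "e = \<delta> / DIM('b)"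
  have e: "e > 0" "DIM('b) * e = \<delta>" using d by (auto simp: e_def)
  have "\<exists>N. one_hidden_layer_mlp \<sigma> N \<and> (\<forall>t. \<bar>f t \<bullet> i - N t\<bar> \<le> e * exp (c * t\<^sup>2))" if "i \<in> Basis" for i
  proof -
    have "\<bar>f t \<bullet> i\<bar> \<le> B" for t using Basis_le_norm[OF that, of "f t"] B[of t] by linarith
    then have "(\<lambda>t. f t \<bullet> i) \<in> gauss_closure \<sigma>"
      using f \<sigma> by (intro bounded_continuous_gauss_closure) (auto intro!: continuous_intros)
    from gauss_closureD[OF this c e(1)] show ?thesis by metis
  qed
  then obtain M where M: "\<And>i. i \<in> Basis \<Longrightarrow> one_hidden_layer_mlp \<sigma> (M i)"
    "\<And>i t. i \<in> Basis \<Longrightarrow> \<bar>f t \<bullet> i - M i t\<bar> \<le> e * exp (c * t\<^sup>2)"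
    by metis
  define N where "N t = (\<Sum>i\<in>Basis. M i t *\<^sub>R i)" for t
  have "one_hidden_layer_mlp \<sigma> N"
    unfolding N_def
    by (intro mlp_sum mlp_linear_image[OF M(1)]) (auto simp: linear_iff algebra_simps)
  moreover have "norm (f t - N t) \<le> \<delta> * exp (c * t\<^sup>2)" for t
  proof -
    have "norm (f t - N t) \<le> (\<Sum>i\<in>Basis. \<bar>(f t - N t) \<bullet> i\<bar>)" by (rule norm_le_l1)
    also have "\<dots> \<le> (\<Sum>i\<in>(Basis :: 'b set). e * exp (c * t\<^sup>2))"
    proof (rule sum_mono)
      fix i :: 'b assume i: "i \<in> Basis"
      have "N t \<bullet> i = M i t" using i by (simp add: N_def inner_sum_left_Basis)
      then show "\<bar>(f t - N t) \<bullet> i\<bar> \<le> e * exp (c * t\<^sup>2)"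
        using M(2)[OF i, of t] by (simp add: inner_diff_left)
    qed
    also have "\<dots> = \<delta> * exp (c * t\<^sup>2)" by (simp flip: e(2))
    finally show ?thesis .
  qed
  ultimately show ?thesis by (rule that)
qed

section \<open>Uniform approximation on compact sets\<close>

text \<open>On a bounded set each \<open>a \<bullet> x\<close> stays in a bounded interval, where
  the Gaussian weight is bounded and the weighted approximation becomes uniform.\<close>

lemma trig_sums_uniform_mlp:
  fixes f :: "'a::euclidean_space \<Rightarrow> real"
  assumes "f \<in> trig_sums" and K: "bounded K" and \<sigma>: "lipschitz \<sigma>" "non_polynomial \<sigma>"
    and "\<delta> > 0"
  shows "\<exists>N. one_hidden_layer_mlp \<sigma> N \<and> (\<forall>x\<in>K. \<bar>f x - N x\<bar> \<le> \<delta>)"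
  using assms(1,5)
proof (induction arbitrary: \<delta>)
  case (cos a b)
  obtain R where R: "R > 0" "\<And>x. x \<in> K \<Longrightarrow> norm x \<le> R"
    using K bounded_pos by blast
  define T where "T = norm a * R"
  have T: "T \<ge> 0" using R by (simp add: T_def)
  \<comment> \<open>The rate is taken to be 1, and the largest value of the weight for arguments up
    to \<open>T\<close> is divided out.\<close>
  define e where "e = \<delta> / exp (1 * T\<^sup>2)"
  have e: "e > 0" "e * exp (1 * T\<^sup>2) = \<delta>" using cos by (auto simp: e_def)
  have cl: "(\<lambda>t. cos (1 * t + b)) \<in> gauss_closure \<sigma>" using \<sigma> by (rule gauss_closure_cos_lipschitz)
  then obtain N where N: "one_hidden_layer_mlp \<sigma> N"
    "\<And>t. \<bar>cos (1 * t + b) - N t\<bar> \<le> e * exp (1 * t\<^sup>2)"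
    using gauss_closureD[OF cl zero_less_one e(1)] by blast
  have "\<bar>cos (a \<bullet> x + b) - N (a \<bullet> x + 0)\<bar> \<le> \<delta>" if "x \<in> K" for x
  proof -
    have "\<bar>a \<bullet> x\<bar> \<le> norm a * norm x" by (rule Cauchy_Schwarz_ineq2)
    also have "\<dots> \<le> T" unfolding T_def using R(2)[OF that] by (intro mult_left_mono) auto
    finally have "(a \<bullet> x)\<^sup>2 \<le> T\<^sup>2" using T by (simp add: abs_le_square_iff[symmetric])
    then have "e * exp (1 * (a \<bullet> x)\<^sup>2) \<le> e * exp (1 * T\<^sup>2)" using e(1) by simp
    then show ?thesis using N(2)[of "a \<bullet> x"] e(2) by simp
  qed
  with mlp_ridge[OF N(1), of a 0] show ?case by blast
next
  case (add f g)
  obtain M where M: "one_hidden_layer_mlp \<sigma> M" "\<And>x. x \<in> K \<Longrightarrow> \<bar>f x - M x\<bar> \<le> \<delta> / 2"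
    using add.IH(1)[of "\<delta>/2"] add.prems by auto
  obtain N where N: "one_hidden_layer_mlp \<sigma> N" "\<And>x. x \<in> K \<Longrightarrow> \<bar>g x - N x\<bar> \<le> \<delta> / 2"
    using add.IH(2)[of "\<delta>/2"] add.prems by auto
  have "\<bar>f x + g x - (M x + N x)\<bar> \<le> \<delta>" if "x \<in> K" for x
    using M(2)[OF that] N(2)[OF that] by linarith
  with mlp_add[OF M(1) N(1)] show ?case by blast
next
  case (scale f r)
  obtain N where N: "one_hidden_layer_mlp \<sigma> N" "\<And>x. x \<in> K \<Longrightarrow> \<bar>f x - N x\<bar> \<le> \<delta> / (\<bar>r\<bar> + 1)"
    using scale.IH[of "\<delta> / (\<bar>r\<bar> + 1)"] scale.prems by (auto simp: divide_pos_pos)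
  have "\<bar>r * f x - r * N x\<bar> \<le> \<delta>" if "x \<in> K" for x
  proof -
    have "\<bar>r * f x - r * N x\<bar> = \<bar>r\<bar> * \<bar>f x - N x\<bar>" by (simp add: abs_mult flip: right_diff_distrib)
    also have "\<dots> \<le> \<bar>r\<bar> * (\<delta> / (\<bar>r\<bar> + 1))" using N(2)[OF that] by (intro mult_left_mono) auto
    also have "\<dots> \<le> \<delta>" using scale.prems by (simp add: field_simps)
    finally show ?thesis .
  qed
  moreover have "one_hidden_layer_mlp \<sigma> (\<lambda>x. r * N x)"
    by (rule mlp_linear_image[OF N(1)]) (simp add: linear_iff algebra_simps)
  ultimately show ?case by (intro exI[of _ "\<lambda>x. r * N x"]) auto
qed

lemma continuous_on_compact_mlp:
  fixes h :: "'a::euclidean_space \<Rightarrow> real"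
  assumes K: "compact K" and h: "continuous_on K h"
    and \<sigma>: "lipschitz \<sigma>" "non_polynomial \<sigma>" and d: "\<delta> > 0"
  obtains N where "one_hidden_layer_mlp \<sigma> N" "\<And>x. x \<in> K \<Longrightarrow> \<bar>h x - N x\<bar> \<le> \<delta>"
proof -
  have sep: "\<exists>f\<in>trig_sums. f x \<noteq> f y" if "x \<noteq> y" for x y :: 'a
  proof -
    \<comment> \<open>Scaled so that \<open>x\<close> and \<open>y\<close> lie half a period apart:
      the cosine is 1 at \<open>y\<close> and -1 at \<open>x\<close>.\<close>
    define a where "a = (pi / ((x - y) \<bullet> (x - y))) *\<^sub>R (x - y)"
    have "a \<bullet> (x - y) = pi" using that by (simp add: a_def)
    then have "cos (a \<bullet> x + - (a \<bullet> y)) \<noteq> cos (a \<bullet> y + - (a \<bullet> y))" by (simp add: inner_diff_right)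
    then show ?thesis
      by (rule bexI[where x = "\<lambda>z. cos (a \<bullet> z + - (a \<bullet> y))"]) (rule trig_sums.cos)
  qed
  have "function_ring_on trig_sums K"
    by (rule function_ring_on.intro)
      (fact K trig_sums_continuous trig_sums.add trig_sums_mult trig_sums_const | erule sep)+
  then obtain f where f: "f \<in> trig_sums" "\<And>x. x \<in> K \<Longrightarrow> \<bar>h x - f x\<bar> < \<delta> / 2"
    using function_ring_on.Stone_Weierstrass_basic[of trig_sums K h "\<delta> / 2"] h d by auto
  obtain N where N: "one_hidden_layer_mlp \<sigma> N" "\<And>x. x \<in> K \<Longrightarrow> \<bar>f x - N x\<bar> \<le> \<delta> / 2"
    using trig_sums_uniform_mlp[OF f(1) compact_imp_bounded[OF K] \<sigma>, of "\<delta> / 2"] d by auto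
  have "\<bar>h x - N x\<bar> \<le> \<delta>" if "x \<in> K" for x
    using f(2)[OF that] N(2)[OF that] by linarith
  with N(1) show ?thesis by (rule that)
qed

section \<open>Growth and continuity of networks\<close>

lemma mlp_linear_growth:
  fixes N :: "real \<Rightarrow> 'b::euclidean_space"
  assumes "one_hidden_layer_mlp \<sigma> N" "lipschitz \<sigma>"
  obtains C where "C \<ge> 0" "\<And>t. norm (N t) \<le> C * (1 + \<bar>t\<bar>)"
proof -
  obtain n :: nat and W b A where N: "\<forall>z. N z = (\<Sum>i<n. \<sigma> (W i \<bullet> z + b i) *\<^sub>R A i)"
    using assms(1) unfolding one_hidden_layer_mlp_def by blast
  obtain L where "L-lipschitz_on UNIV \<sigma>" using assms(2) unfolding lipschitz_def by blast
  then have L: "L \<ge> 0" "\<bar>\<sigma> x - \<sigma> y\<bar> \<le> L * \<bar>x - y\<bar>" for x y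
    unfolding lipschitz_on_def by (simp_all add: dist_real_def)
  define D where "D i = \<bar>\<sigma> (b i)\<bar> + L * \<bar>W i\<bar>" for i
  have D: "\<bar>\<sigma> (W i \<bullet> t + b i)\<bar> \<le> D i * (1 + \<bar>t\<bar>)" for i t
  proof -
    have "\<bar>\<sigma> (W i \<bullet> t + b i)\<bar> \<le> \<bar>\<sigma> (b i)\<bar> + L * (\<bar>W i\<bar> * \<bar>t\<bar>)"
      using L(2)[of "W i \<bullet> t + b i" "b i"] by (simp add: abs_mult)
    also have "\<dots> \<le> D i * (1 + \<bar>t\<bar>)" using L(1) by (simp add: D_def algebra_simps)
    finally show ?thesis .
  qed
  have "norm (N t) \<le> (\<Sum>i<n. D i * norm (A i)) * (1 + \<bar>t\<bar>)" for t
  proof -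
    have "norm (N t) \<le> (\<Sum>i<n. \<bar>\<sigma> (W i \<bullet> t + b i)\<bar> * norm (A i))"
      using N by (simp add: sum_norm_le)
    also have "\<dots> \<le> (\<Sum>i<n. (D i * (1 + \<bar>t\<bar>)) * norm (A i))"
      by (intro sum_mono mult_right_mono D) auto
    finally show ?thesis by (simp add: sum_distrib_right sum_distrib_left mult_ac)
  qed
  moreover have "(\<Sum>i<n. D i * norm (A i)) \<ge> 0"
    using L(1) by (intro sum_nonneg) (auto simp: D_def)
  ultimately show ?thesis using that by blast
qed

lemma mlp_continuous:
  assumes "one_hidden_layer_mlp \<sigma> N" "lipschitz \<sigma>"
  shows "continuous_on S N"
proof -
  obtain n :: nat and W b A where N: "\<forall>z. N z = (\<Sum>i<n. \<sigma> (W i \<bullet> z + b i) *\<^sub>R A i)"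
    using assms(1) unfolding one_hidden_layer_mlp_def by blast
  obtain L where "L-lipschitz_on UNIV \<sigma>" using assms(2) unfolding lipschitz_def by blast
  then have "continuous_on UNIV \<sigma>" by (rule lipschitz_on_continuous_on)
  then have "continuous_on S (\<lambda>z. \<sigma> (W i \<bullet> z + b i))" for i
    by (rule continuous_on_compose2) (auto intro!: continuous_intros)
  then have "continuous_on S (\<lambda>z. \<Sum>i<n. \<sigma> (W i \<bullet> z + b i) *\<^sub>R A i)"
    by (intro continuous_intros)
  then show ?thesis using N by (simp add: continuous_on_cong[of S S N])
qed

section \<open>Gaussian integrals and feature maps\<close>

text \<open>Up to the factor \<open>sqrt 2\<close> the integrand is the normal density of variance
  2.\<close>

lemma integrable_std_normal_exp_square:
  "integrable lborel (\<lambda>t. std_normal_density t * exp (t\<^sup>2 / 4))"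
proof -
  have "std_normal_density t * exp (t\<^sup>2 / 4) = sqrt 2 * normal_density 0 (sqrt 2) t" for t
  proof -
    have "exp (- t\<^sup>2 / 2) * exp (t\<^sup>2 / 4) = exp (- t\<^sup>2 / 4)"
      by (simp flip: exp_add)
    then show ?thesis
      by (simp add: normal_density_def real_sqrt_mult mult.assoc) (simp add: field_simps)
  qed
  then show ?thesis by simp
qed

text \<open>Passes from the coordinates used in the density to the \<open>Basis\<close> used in the
  product rule for integrals over \<open>lborel\<close>.\<close>

lemma prod_Basis_vec:
  fixes x :: "real ^ 'd" and F :: "real \<Rightarrow> 'b::comm_monoid_mult"
  shows "(\<Prod>b\<in>Basis. F (x \<bullet> b)) = (\<Prod>i\<in>UNIV. F (x $ i))"
proof -
  have B: "(Basis :: (real ^ 'd) set) = (\<lambda>i. axis i 1) ` UNIV"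
    by (auto simp: Basis_vec_def)
  have "inj (\<lambda>i. axis i (1::real) :: real ^ 'd)"
    by (auto simp: inj_on_def axis_eq_axis)
  then show ?thesis
    unfolding B by (subst prod.reindex) (auto simp: inner_axis)
qed

lemma std_gaussian_density_measurable [measurable]:
  "(\<lambda>\<omega> :: real ^ 'd. \<Prod>i\<in>UNIV. std_normal_density (\<omega> $ i)) \<in> borel_measurable borel"
  unfolding prod_Basis_vec[symmetric] by measurable

lemma sets_std_gaussian [measurable_cong, simp]: "sets std_gaussian = sets borel"
  by (simp add: std_gaussian_def)

lemma space_std_gaussian [simp]: "space std_gaussian = UNIV"
  by (simp add: std_gaussian_def)

text \<open>Density and weight both factor over the coordinates, which leaves a power of a
  one-dimensional integral. This function dominates all network terms below.\<close>

lemma integrable_std_gaussian_exp_norm: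
  "integrable std_gaussian (\<lambda>\<omega> :: real ^ 'd. exp ((norm \<omega>)\<^sup>2 / 4))"
proof -
  define F where "F t = std_normal_density t * exp (t\<^sup>2 / 4)" for t :: real
  have F0: "F t \<ge> 0" for t by (simp add: F_def)
  have Fm [measurable]: "F \<in> borel_measurable borel" unfolding F_def by measurable
  have split: "(\<Prod>i\<in>UNIV. std_normal_density (\<omega> $ i)) * exp ((norm \<omega>)\<^sup>2 / 4)
      = (\<Prod>b\<in>Basis. F (\<omega> \<bullet> b))" for \<omega> :: "real ^ 'd"
  proof -
    have "(norm \<omega>)\<^sup>2 / 4 = (\<Sum>i\<in>UNIV. (\<omega> $ i)\<^sup>2 / 4)"
      by (simp add: norm_vec_def L2_set_def sum_nonneg sum_divide_distrib)
    then show ?thesis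
      unfolding prod_Basis_vec by (simp add: F_def exp_sum prod.distrib)
  qed
  have "integrable lborel (\<lambda>\<omega> :: real ^ 'd. \<Prod>b\<in>Basis. F (\<omega> \<bullet> b))"
  proof (rule integrableI_nonneg)
    have "(\<integral>\<^sup>+ \<omega>. ennreal (\<Prod>b\<in>Basis. F (\<omega> \<bullet> b)) \<partial>(lborel :: (real ^ 'd) measure))
        = (\<integral>\<^sup>+ \<omega>. (\<Prod>b\<in>Basis. ennreal (F (\<omega> \<bullet> b))) \<partial>(lborel :: (real ^ 'd) measure))"
      using F0 by (simp add: prod_ennreal)
    also have "\<dots> = (\<Prod>b\<in>(Basis :: (real ^ 'd) set). \<integral>\<^sup>+ t. ennreal (F t) \<partial>lborel)"
      by (rule nn_integral_lborel_prod) auto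
    also have "\<dots> < \<infinity>"
    proof -
      have "(\<integral>\<^sup>+ t. ennreal (F t) \<partial>lborel) < \<infinity>"
        using integrable_std_normal_exp_square F0
        unfolding F_def[symmetric] by (simp add: nn_integral_eq_integral)
      then show ?thesis by (simp add: power_less_top_ennreal)
    qed
    finally show "(\<integral>\<^sup>+ \<omega>. ennreal (\<Prod>b\<in>Basis. F (\<omega> \<bullet> b)) \<partial>(lborel :: (real ^ 'd) measure)) < \<infinity>" .
  qed (auto intro!: AE_I2 prod_nonneg F0)
  then show ?thesis
    unfolding std_gaussian_def
    by (subst integrable_density) (auto simp: split intro!: AE_I2 prod_nonneg)
qed

text \<open>At each point the indicator is eventually 0, so dominated convergence with bound
  \<open>\<bar>g \<omega>\<bar>\<close> applies.\<close>

lemma integral_norm_tail: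
  fixes g :: "'a::euclidean_space \<Rightarrow> real"
  assumes g: "integrable M g" and [measurable_cong]: "sets M = sets borel" and "\<eta> > 0"
  obtains n :: nat where "(\<integral>\<omega>. g \<omega> * indicator {\<omega>. norm \<omega> > real n} \<omega> \<partial>M) < \<eta>"
    "integrable M (\<lambda>\<omega>. g \<omega> * indicator {\<omega>. norm \<omega> > real n} \<omega>)"
proof -
  note [measurable] = borel_measurable_integrable[OF g]
  have "(\<lambda>n. \<integral>\<omega>. g \<omega> * indicator {\<omega>. norm \<omega> > real n} \<omega> \<partial>M) \<longlonglongrightarrow> (\<integral>\<omega>. 0 \<partial>M)"
  proof (rule integral_dominated_convergence[where w = "\<lambda>\<omega>. \<bar>g \<omega>\<bar>"])
    show "AE \<omega> in M. (\<lambda>n. g \<omega> * indicator {\<omega>. norm \<omega> > real n} \<omega>) \<longlonglongrightarrow> 0"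
    proof (rule AE_I2)
      fix \<omega> :: 'a
      obtain m where m: "norm \<omega> < real m" using reals_Archimedean2 by blast
      have "eventually (\<lambda>n. g \<omega> * indicator {\<omega>. norm \<omega> > real n} \<omega> = 0) sequentially"
        using eventually_ge_at_top[of m] by eventually_elim (use m in \<open>auto simp: indicator_def\<close>)
      then show "(\<lambda>n. g \<omega> * indicator {\<omega>. norm \<omega> > real n} \<omega>) \<longlonglongrightarrow> 0"
        by (rule tendsto_eventually)
    qed
  qed (use g in \<open>auto simp: indicator_def\<close>)
  then have "(\<lambda>n. \<integral>\<omega>. g \<omega> * indicator {\<omega>. norm \<omega> > real n} \<omega> \<partial>M) \<longlonglongrightarrow> 0" by simp
  from order_tendstoD(2)[OF this \<open>\<eta> > 0\<close>] obtain n :: nat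
    where "(\<integral>\<omega>. g \<omega> * indicator {\<omega>. norm \<omega> > real n} \<omega> \<partial>M) < \<eta>"
    by (auto simp: eventually_sequentially)
  moreover have "integrable M (\<lambda>\<omega>. g \<omega> * indicator {\<omega>. norm \<omega> > real n} \<omega>)"
    using g by (rule Bochner_Integration.integrable_bound) (auto simp: indicator_def)
  ultimately show ?thesis by (rule that)
qed

section \<open>Perturbation of inner products\<close>

lemma abs_inner_weighted_AM_GM:
  fixes a b :: "'b::real_inner"
  assumes "l > 0"
  shows "\<bar>a \<bullet> b\<bar> \<le> (l * (norm a)\<^sup>2 + (norm b)\<^sup>2 / l) / 2"
proof -
  have "0 \<le> (l * norm a - norm b)\<^sup>2" by simp
  then have "2 * l * (norm a * norm b) \<le> l\<^sup>2 * (norm a)\<^sup>2 + (norm b)\<^sup>2"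
    by (simp add: power2_eq_square algebra_simps)
  then have "norm a * norm b \<le> (l * (norm a)\<^sup>2 + (norm b)\<^sup>2 / l) / 2"
    using assms by (simp add: field_simps power2_eq_square)
  then show ?thesis using Cauchy_Schwarz_ineq2[of a b] by linarith
qed

text \<open>With \<open>d\<close> and \<open>e\<close> the two errors, the difference is
  \<open>u \<bullet> e + v \<bullet> d - d \<bullet> e\<close>. The weight \<open>l\<close> keeps
  the contribution of the fixed bound \<open>G\<close> small and puts the large factor
  \<open>1 / l\<close> on \<open>E\<close>, which can be made small afterwards. Being pointwise, the
  bound can be integrated directly.\<close>

lemma inner_perturbation:
  fixes u v p q :: "'b::real_inner"
  assumes "l > 0" "(norm u)\<^sup>2 \<le> G" "(norm v)\<^sup>2 \<le> G"
    and "(norm (u - p))\<^sup>2 \<le> E" "(norm (v - q))\<^sup>2 \<le> E"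
  shows "\<bar>u \<bullet> v - p \<bullet> q\<bar> \<le> l * G + (1 / l + 1) * E"
proof -
  define d e where "d = u - p" and "e = v - q"
  have de: "(norm d)\<^sup>2 \<le> E" "(norm e)\<^sup>2 \<le> E" using assms by (auto simp: d_def e_def)
  have bound: "(l * (norm a)\<^sup>2 + (norm b)\<^sup>2 / l) / 2 \<le> (l * G + E / l) / 2"
    if "(norm a)\<^sup>2 \<le> G" "(norm b)\<^sup>2 \<le> E" for a b :: 'b
    using that assms(1) by (intro divide_right_mono add_mono mult_left_mono) auto
  have "u \<bullet> v - p \<bullet> q = u \<bullet> e + v \<bullet> d - d \<bullet> e"
    by (simp add: d_def e_def algebra_simps inner_commute)
  then have "\<bar>u \<bullet> v - p \<bullet> q\<bar> \<le> \<bar>u \<bullet> e\<bar> + \<bar>v \<bullet> d\<bar> + \<bar>d \<bullet> e\<bar>" by linarith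
  also have "\<dots> \<le> (l * G + E / l) / 2 + (l * G + E / l) / 2 + E"
  proof (intro add_mono)
    show "\<bar>u \<bullet> e\<bar> \<le> (l * G + E / l) / 2"
      using abs_inner_weighted_AM_GM[OF assms(1), of u e] bound[OF assms(2) de(2)] by linarith
    show "\<bar>v \<bullet> d\<bar> \<le> (l * G + E / l) / 2"
      using abs_inner_weighted_AM_GM[OF assms(1), of v d] bound[OF assms(3) de(1)] by linarith
    show "\<bar>d \<bullet> e\<bar> \<le> E"
      using abs_inner_weighted_AM_GM[of 1 d e] de by simp
  qed
  also have "\<dots> = l * G + (1 / l + 1) * E" by (simp add: algebra_simps)
  finally show ?thesis .
qed

lemma norm_sum3_square_le:
  fixes a b c :: "'b::real_normed_vector"
  shows "(norm (a + b + c))\<^sup>2 \<le> 3 * (norm a)\<^sup>2 + 3 * (norm b)\<^sup>2 + 3 * (norm c)\<^sup>2"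
proof -
  have "norm (a + b + c) \<le> norm a + norm b + norm c"
    by (meson norm_triangle_le norm_triangle_ineq add_right_mono order_trans)
  then have "(norm (a + b + c))\<^sup>2 \<le> (norm a + norm b + norm c)\<^sup>2"
    by (intro power_mono) auto
  also have "\<dots> \<le> 3 * (norm a)\<^sup>2 + 3 * (norm b)\<^sup>2 + 3 * (norm c)\<^sup>2"
    using zero_le_power2[of "norm a - norm b"] zero_le_power2[of "norm b - norm c"]
      zero_le_power2[of "norm a - norm c"]
    by (simp add: power2_eq_square algebra_simps)
  finally show ?thesis .
qed

lemma continuous_cutoff:
  fixes \<psi> :: "real \<Rightarrow> 'b::real_normed_vector"
  assumes \<psi>: "continuous_on UNIV \<psi>" and T: "T > 0"
  obtains f B where "continuous_on UNIV f" "\<And>t. norm (f t) \<le> B"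
    "\<And>t. \<bar>t\<bar> \<le> T \<Longrightarrow> f t = \<psi> t" "\<And>t. norm (\<psi> t - f t) \<le> norm (\<psi> t)"
proof -
  \<comment> \<open>A trapezoid: 1 up to \<open>\<bar>t\<bar> = T\<close>, then linear down to 0 at
    \<open>\<bar>t\<bar> = 2 * T\<close>.\<close>
  define \<tau> where "\<tau> t = max 0 (min 1 (2 - \<bar>t\<bar> / T))" for t
  have \<tau>: "0 \<le> \<tau> t" "\<tau> t \<le> 1" for t by (auto simp: \<tau>_def)
  have one: "\<tau> t = 1" if "\<bar>t\<bar> \<le> T" for t using that T by (simp add: \<tau>_def field_simps)
  have zero: "\<tau> t = 0" if "\<bar>t\<bar> > 2 * T" for t using that T by (simp add: \<tau>_def field_simps)
  have "compact (\<psi> ` {- (2 * T)..2 * T})"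
    using \<psi> by (intro compact_continuous_image continuous_on_subset[OF \<psi>]) auto
  then obtain B where B: "B > 0" "\<And>t. t \<in> {- (2 * T)..2 * T} \<Longrightarrow> norm (\<psi> t) \<le> B"
    using compact_imp_bounded bounded_pos by (metis imageI)
  show ?thesis
  proof (rule that[of "\<lambda>t. \<tau> t *\<^sub>R \<psi> t" B])
    have "continuous_on UNIV \<tau>" unfolding \<tau>_def using T by (intro continuous_intros) auto
    then show "continuous_on UNIV (\<lambda>t. \<tau> t *\<^sub>R \<psi> t)" using \<psi> by (intro continuous_intros)
    show "norm (\<tau> t *\<^sub>R \<psi> t) \<le> B" for t
    proof (cases "\<bar>t\<bar> \<le> 2 * T")
      case True
      then have "norm (\<psi> t) \<le> B" by (intro B(2)) (auto simp: abs_le_iff)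
      moreover have "\<tau> t * norm (\<psi> t) \<le> 1 * norm (\<psi> t)" using \<tau> by (intro mult_right_mono) auto
      ultimately show ?thesis using \<tau>(1)[of t] by simp
    next
      case False
      then show ?thesis using zero[of t] B(1) by simp
    qed
    show "\<tau> t *\<^sub>R \<psi> t = \<psi> t" if "\<bar>t\<bar> \<le> T" for t using one[OF that] by simp
    show "norm (\<psi> t - \<tau> t *\<^sub>R \<psi> t) \<le> norm (\<psi> t)" for t
    proof -
      have "\<psi> t - \<tau> t *\<^sub>R \<psi> t = (1 - \<tau> t) *\<^sub>R \<psi> t" by (simp add: algebra_simps)
      then have "norm (\<psi> t - \<tau> t *\<^sub>R \<psi> t) = (1 - \<tau> t) * norm (\<psi> t)" using \<tau>(2)[of t] by simp
      also have "\<dots> \<le> 1 * norm (\<psi> t)" using \<tau>(1)[of t] by (intro mult_right_mono) auto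
      finally show ?thesis by simp
    qed
  qed
qed

text \<open>For fixed nonzero \<open>x\<close> with \<open>h x \<noteq> 0\<close>, the line
  \<open>\<omega> = (t / (x \<bullet> x)) *\<^sub>R x\<close> has
  \<open>\<omega> \<bullet> x = t\<close>, so the feature along it is
  \<open>h x *\<^sub>R \<psi> t\<close>, and \<open>h x\<close> can be divided out.\<close>

lemma feature_continuous_imp_continuous:
  fixes h :: "real ^ 'd \<Rightarrow> real" and \<psi> :: "real \<Rightarrow> real ^ 'D"
  assumes h: "continuous_on UNIV h" and nz: "h x0 \<noteq> 0"
    and \<phi>: "continuous_on UNIV (\<lambda>(\<omega>, x). feature h \<psi> \<omega> x)"
  shows "continuous_on UNIV \<psi>"
proof -
  have "open {x. h x \<noteq> 0}"
    using h by (intro open_Collect_neq continuous_intros) auto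
  then obtain e where e: "e > 0" "ball x0 e \<subseteq> {x. h x \<noteq> 0}"
    using nz by (auto simp: open_contains_ball)
  \<comment> \<open>If \<open>x0\<close> is the origin, continuity of \<open>h\<close> provides a
    nearby nonzero point along some coordinate axis.\<close>
  obtain x where x: "x \<noteq> 0" "h x \<noteq> 0"
  proof (cases "x0 = 0")
    case True
    define u where "u = (e / 2) *\<^sub>R (axis undefined 1 :: real ^ 'd)"
    have "u \<in> ball x0 e" "u \<noteq> 0" using e(1) True by (auto simp: u_def axis_eq_0_iff)
    then show ?thesis using that[of u] e(2) by auto
  qed (use nz that in auto)
  have "continuous_on UNIV (\<lambda>t::real. feature h \<psi> ((t / (x \<bullet> x)) *\<^sub>R x) x)"
  proof -
    have "continuous_on UNIV (\<lambda>t::real. ((t / (x \<bullet> x)) *\<^sub>R x, x))"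
      using x(1) by (intro continuous_intros) auto
    from continuous_on_compose2[OF \<phi> this] show ?thesis by simp
  qed
  moreover have "feature h \<psi> ((t / (x \<bullet> x)) *\<^sub>R x) x = h x *\<^sub>R \<psi> t" for t
    using x(1) by (simp add: feature_def)
  ultimately have "continuous_on UNIV (\<lambda>t. h x *\<^sub>R \<psi> t)" by simp
  then have "continuous_on UNIV (\<lambda>t. (1 / h x) *\<^sub>R (h x *\<^sub>R \<psi> t))"
    by (rule continuous_on_scaleR[OF continuous_on_const])
  then show ?thesis using x(2) by simp
qed

lemma feature_inner_measurable [measurable]:
  assumes "continuous_on UNIV \<psi>"
  shows "(\<lambda>\<omega>. feature h \<psi> \<omega> x \<bullet> feature h \<psi> \<omega> y) \<in> borel_measurable std_gaussian"
proof -
  have "continuous_on UNIV (\<lambda>\<omega>. \<psi> (\<omega> \<bullet> z))" for z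
    by (rule continuous_on_compose2[OF assms]) (auto intro!: continuous_intros)
  then have "continuous_on UNIV (\<lambda>\<omega>. feature h \<psi> \<omega> x \<bullet> feature h \<psi> \<omega> y)"
    unfolding feature_def by (intro continuous_intros)
  then show ?thesis
    by (simp add: borel_measurable_continuous_onI measurable_cong_sets[OF sets_std_gaussian refl])
qed

text \<open>Makes the network kernel a genuine expectation, since a Bochner integral defaults to 0
  when integrability fails. Linear growth of both factors is dominated by the integrable
  exponential.\<close>

lemma integrable_feature_inner_linear_growth:
  fixes \<psi> :: "real \<Rightarrow> real ^ 'D"
  assumes \<psi>: "continuous_on UNIV \<psi>" and C: "C \<ge> 0" "\<And>t. norm (\<psi> t) \<le> C * (1 + \<bar>t\<bar>)"
  shows "integrable std_gaussian (\<lambda>\<omega>. feature h \<psi> \<omega> x \<bullet> feature h \<psi> \<omega> y)"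
proof -
  have bd: "norm (feature h \<psi> \<omega> z) \<le> (\<bar>h z\<bar> * C * (1 + norm z)) * (1 + norm \<omega>)" for \<omega> z
  proof -
    have "\<bar>\<omega> \<bullet> z\<bar> \<le> norm \<omega> * norm z" by (rule Cauchy_Schwarz_ineq2)
    then have "1 + \<bar>\<omega> \<bullet> z\<bar> \<le> (1 + norm z) * (1 + norm \<omega>)" 
      by (simp add: algebra_simps add_increasing)
    then have "C * (1 + \<bar>\<omega> \<bullet> z\<bar>) \<le> C * ((1 + norm z) * (1 + norm \<omega>))"
      using C(1) by (intro mult_left_mono)
    then have "norm (\<psi> (\<omega> \<bullet> z)) \<le> C * ((1 + norm z) * (1 + norm \<omega>))"
      using C(2)[of "\<omega> \<bullet> z"] by linarith
    then have "\<bar>h z\<bar> * norm (\<psi> (\<omega> \<bullet> z)) \<le> \<bar>h z\<bar> * (C * ((1 + norm z) * (1 + norm \<omega>)))"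
      by (intro mult_left_mono) auto
    then show ?thesis by (simp add: feature_def mult.assoc)
  qed
  define D where "D z = \<bar>h z\<bar> * C * (1 + norm z)" for z
  have D: "D z \<ge> 0" for z using C(1) by (simp add: D_def)
  show ?thesis
  proof (rule Bochner_Integration.integrable_bound)
    show "integrable std_gaussian (\<lambda>\<omega>. (8 * (D x * D y)) * exp ((norm \<omega>)\<^sup>2 / 4))"
      by (intro integrable_mult_right integrable_std_gaussian_exp_norm)
    show "AE \<omega> in std_gaussian. norm (feature h \<psi> \<omega> x \<bullet> feature h \<psi> \<omega> y)
        \<le> norm ((8 * (D x * D y)) * exp ((norm \<omega>)\<^sup>2 / 4))"
    proof (rule AE_I2)
      fix \<omega> :: "real ^ 'a"
      have "\<bar>feature h \<psi> \<omega> x \<bullet> feature h \<psi> \<omega> y\<bar> \<le> norm (feature h \<psi> \<omega> x) * norm (feature h \<psi> \<omega> y)"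
        by (rule Cauchy_Schwarz_ineq2)
      also have "\<dots> \<le> (D x * (1 + norm \<omega>)) * (D y * (1 + norm \<omega>))"
        using bd D by (intro mult_mono) (auto simp: D_def)
      also have "\<dots> = (D x * D y) * (1 + norm \<omega>)\<^sup>2" by (simp add: power2_eq_square algebra_simps)
      also have "\<dots> \<le> (D x * D y) * (8 * exp ((norm \<omega>)\<^sup>2 / 4))"
      proof (intro mult_left_mono)
        have "(1 + norm \<omega>)\<^sup>2 \<le> 8 * (1 + (norm \<omega>)\<^sup>2 / 4)"
          using zero_le_power2[of "1 - norm \<omega>"] by (simp add: power2_eq_square algebra_simps)
        then show "(1 + norm \<omega>)\<^sup>2 \<le> 8 * exp ((norm \<omega>)\<^sup>2 / 4)"
          using mult_left_mono[OF exp_ge_add_one_self[of "(norm \<omega>)\<^sup>2 / 4"], of 8]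
          by (rule order_trans) simp
      qed (use D in auto)
      finally show "norm (feature h \<psi> \<omega> x \<bullet> feature h \<psi> \<omega> y)
          \<le> norm ((8 * (D x * D y)) * exp ((norm \<omega>)\<^sup>2 / 4))"
        using D by (simp add: abs_mult mult_ac)
    qed
  qed (use \<psi> in measurable)
qed

text \<open>The error \<open>\<phi> - \<phi>\<^sub>N\<^sub>N\<close> is split as \<open>h (\<psi> - f) + h (f - N) + (h - h\<^sub>N) N\<close> with the cutoff \<open>f\<close> of
  \<open>\<psi>\<close>: the first part lives where \<open>norm \<omega>\<close> is large and is dominated by \<open>g\<close>, the two others are
  small multiples of \<open>exp ((norm \<omega>)\<^sup>2 / 8)\<close>, which is square integrable.\<close>

lemma feature_mlp_approx:
  fixes h :: "real ^ 'd \<Rightarrow> real" and \<psi> :: "real \<Rightarrow> real ^ 'D"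
  assumes K: "compact K" and h: "continuous_on UNIV h" and \<psi>: "continuous_on UNIV \<psi>"
    and g: "integrable std_gaussian g"
    and dom: "\<And>x \<omega>. x \<in> K \<Longrightarrow> (norm (feature h \<psi> \<omega> x))\<^sup>2 \<le> g \<omega>" and g0: "\<And>\<omega>. 0 \<le> g \<omega>"
    and \<sigma>: "lipschitz \<sigma>" "non_polynomial \<sigma>" and \<sigma>': "lipschitz \<sigma>'" "non_polynomial \<sigma>'"
    and \<eta>: "\<eta> > 0"
  obtains hN N E where "one_hidden_layer_mlp \<sigma>' hN" "one_hidden_layer_mlp \<sigma> N"
    "integrable std_gaussian E" "(\<integral>\<omega>. E \<omega> \<partial>std_gaussian) \<le> \<eta>"
    "\<forall>x\<in>K. \<forall>\<omega>. (norm (feature h \<psi> \<omega> x - feature hN N \<omega> x))\<^sup>2 \<le> E \<omega>"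
proof -
  define e where "e \<omega> = exp ((norm \<omega>)\<^sup>2 / 4)" for \<omega> :: "real ^ 'd"
  have e_int: "integrable std_gaussian e" unfolding e_def by (rule integrable_std_gaussian_exp_norm)
  define \<kappa> where "\<kappa> = (\<integral>\<omega>. e \<omega> \<partial>std_gaussian)"
  have \<kappa>: "\<kappa> \<ge> 0" unfolding \<kappa>_def by (intro Bochner_Integration.integral_nonneg) (auto simp: e_def)
  obtain R0 where R0: "\<And>x. x \<in> K \<Longrightarrow> norm x \<le> R0"
    using compact_imp_bounded[OF K] unfolding bounded_iff by blast
  \<comment> \<open>The lower bound 1 keeps \<open>c\<close> below well defined even when
    \<open>K\<close> contains only the origin.\<close>
  define R where "R = max 1 R0"
  have R: "R \<ge> 1" "\<And>x. x \<in> K \<Longrightarrow> norm x \<le> R" using R0 by (auto simp: R_def intro: max.coboundedI2)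
  have "compact (h ` K)"
    using K h by (intro compact_continuous_image continuous_on_subset[OF h]) auto
  then obtain H where H: "H > 0" "\<And>x. x \<in> K \<Longrightarrow> \<bar>h x\<bar> \<le> H"
    using compact_imp_bounded bounded_pos by (metis imageI real_norm_def)
  \<comment> \<open>Each of the three error parts may take \<open>\<eta> / 3\<close>; the square of
    a sum of three terms costs a further factor 3.\<close>
  obtain n :: nat where
    tail: "(\<integral>\<omega>. g \<omega> * indicator {\<omega>. norm \<omega> > real n} \<omega> \<partial>std_gaussian) < \<eta> / 9" and
    tail_int: "integrable std_gaussian (\<lambda>\<omega>. g \<omega> * indicator {\<omega>. norm \<omega> > real n} \<omega>)"
    using integral_norm_tail[OF g sets_std_gaussian, of "\<eta> / 9"] \<eta> by auto
  \<comment> \<open>For \<open>norm \<omega> \<le> real n\<close> and \<open>x\<close> in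
    \<open>K\<close> the argument \<open>\<omega> \<bullet> x\<close> stays within \<open>T\<close>,
    where the cutoff agrees with \<open>\<psi>\<close>. The summand 1 makes \<open>T\<close>
    positive when \<open>n = 0\<close>.\<close>
  define T where "T = real n * R + 1"
  have T: "T > 0" using R(1) by (auto simp: T_def intro!: add_nonneg_pos)
  obtain f B where f: "continuous_on UNIV f" "\<And>t. norm (f t) \<le> B"
    "\<And>t. \<bar>t\<bar> \<le> T \<Longrightarrow> f t = \<psi> t" "\<And>t. norm (\<psi> t - f t) \<le> norm (\<psi> t)"
    using continuous_cutoff[OF \<psi> T] by blast
  \<comment> \<open>With this rate the squared weight
    \<open>exp (2 * c * (\<omega> \<bullet> x)\<^sup>2)\<close> is at most \<open>e \<omega>\<close>
    for every \<open>x\<close> in \<open>K\<close>.\<close>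
  define c where "c = 1 / (8 * R\<^sup>2)"
  have c: "c > 0" using R(1) by (simp add: c_def)
  have exp_le: "(exp (c * (\<omega> \<bullet> x)\<^sup>2))\<^sup>2 \<le> e \<omega>" if "x \<in> K" for \<omega> x
  proof -
    have "\<bar>\<omega> \<bullet> x\<bar> \<le> norm \<omega> * norm x" by (rule Cauchy_Schwarz_ineq2)
    also have "\<dots> \<le> norm \<omega> * R" using R(2)[OF that] by (intro mult_left_mono) auto
    finally have "(\<omega> \<bullet> x)\<^sup>2 \<le> (norm \<omega> * R)\<^sup>2" by (metis abs_ge_zero power2_abs power_mono)
    then have "2 * (c * (\<omega> \<bullet> x)\<^sup>2) \<le> 2 * (c * (norm \<omega> * R)\<^sup>2)" using c by simp
    also have "\<dots> = (norm \<omega>)\<^sup>2 / 4" using R(1) by (simp add: c_def power_mult_distrib)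
    finally show ?thesis by (simp add: e_def flip: exp_double)
  qed
  have small: "\<exists>d>0. 3 * (a * d\<^sup>2) * \<kappa> \<le> \<eta> / 3" if "a \<ge> 0" for a :: real
  proof -
    define D where "D = a * \<kappa> + 1"
    define d where "d = sqrt (\<eta> / (9 * D))"
    have D: "D > 0" using that \<kappa> by (simp add: D_def add_nonneg_pos)
    then have d: "d > 0" "d\<^sup>2 = \<eta> / (9 * D)" using \<eta> by (auto simp: d_def)
    have "3 * (a * d\<^sup>2) * \<kappa> = \<eta> / 3 * (a * \<kappa> / D)" using D by (simp add: d(2) field_simps)
    also have "\<dots> \<le> \<eta> / 3 * 1" using D \<eta> by (intro mult_left_mono) (auto simp: D_def)
    finally show ?thesis using d(1) by (intro exI[of _ d]) auto
  qed
  obtain \<delta> where \<delta>: "\<delta> > 0" "3 * (H\<^sup>2 * \<delta>\<^sup>2) * \<kappa> \<le> \<eta> / 3" using small[of "H\<^sup>2"] by auto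
  obtain N where N: "one_hidden_layer_mlp \<sigma> N" "\<And>t. norm (f t - N t) \<le> \<delta> * exp (c * t\<^sup>2)"
    using bounded_continuous_vector_mlp[OF f(1,2) \<sigma> c \<delta>(1)] by blast
  define A where "A = B + \<delta>"
  have N_bound: "norm (N t) \<le> A * exp (c * t\<^sup>2)" for t
  proof -
    have B0: "B \<ge> 0" using f(2)[of 0] norm_ge_zero[of "f 0"] by linarith
    have "norm (N t) \<le> norm (f t) + norm (f t - N t)" by (metis norm_minus_commute norm_triangle_sub)
    also have "\<dots> \<le> B * 1 + \<delta> * exp (c * t\<^sup>2)" using f(2)[of t] N(2)[of t] by simp
    also have "\<dots> \<le> B * exp (c * t\<^sup>2) + \<delta> * exp (c * t\<^sup>2)"
      using B0 c by (intro add_right_mono mult_left_mono) auto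
    finally show ?thesis by (simp add: A_def algebra_simps)
  qed
  \<comment> \<open>The order of choices matters: the tolerance for \<open>hN\<close> depends on the
    size \<open>A\<close> of the network \<open>N\<close>, which must be fixed first.\<close>
  obtain \<theta> where \<theta>: "\<theta> > 0" "3 * (A\<^sup>2 * \<theta>\<^sup>2) * \<kappa> \<le> \<eta> / 3" using small[of "A\<^sup>2"] by auto
  obtain hN where hN: "one_hidden_layer_mlp \<sigma>' hN" "\<And>x. x \<in> K \<Longrightarrow> \<bar>h x - hN x\<bar> \<le> \<theta>"
    using continuous_on_compact_mlp[OF K continuous_on_subset[OF h subset_UNIV] \<sigma>' \<theta>(1)] by blast
  define E where "E \<omega> = 3 * (g \<omega> * indicator {\<omega>. norm \<omega> > real n} \<omega>)
      + 3 * (H\<^sup>2 * \<delta>\<^sup>2) * e \<omega> + 3 * (A\<^sup>2 * \<theta>\<^sup>2) * e \<omega>" for \<omega>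
  show ?thesis
  proof (rule that[OF hN(1) N(1)])
    show "integrable std_gaussian E" unfolding E_def
      by (intro Bochner_Integration.integrable_add integrable_mult_right tail_int e_int)
    have "(\<integral>\<omega>. E \<omega> \<partial>std_gaussian)
        = 3 * (\<integral>\<omega>. g \<omega> * indicator {\<omega>. norm \<omega> > real n} \<omega> \<partial>std_gaussian)
          + 3 * (H\<^sup>2 * \<delta>\<^sup>2) * \<kappa> + 3 * (A\<^sup>2 * \<theta>\<^sup>2) * \<kappa>"
      unfolding E_def \<kappa>_def using tail_int e_int
      by (simp add: Bochner_Integration.integral_add)
    also have "\<dots> \<le> \<eta> / 3 + \<eta> / 3 + \<eta> / 3" using tail \<delta>(2) \<theta>(2) by (intro add_mono) auto
    finally show "(\<integral>\<omega>. E \<omega> \<partial>std_gaussian) \<le> \<eta>" by simp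
    show "\<forall>x\<in>K. \<forall>\<omega>. (norm (feature h \<psi> \<omega> x - feature hN N \<omega> x))\<^sup>2 \<le> E \<omega>"
    proof (intro ballI allI)
      fix x \<omega> assume x: "x \<in> K"
      let ?t = "\<omega> \<bullet> x"
      have split: "feature h \<psi> \<omega> x - feature hN N \<omega> x
          = h x *\<^sub>R (\<psi> ?t - f ?t) + h x *\<^sub>R (f ?t - N ?t) + (h x - hN x) *\<^sub>R N ?t"
        by (simp add: feature_def algebra_simps)
      have 1: "(norm (h x *\<^sub>R (\<psi> ?t - f ?t)))\<^sup>2 \<le> g \<omega> * indicator {\<omega>. norm \<omega> > real n} \<omega>"
      proof (cases "norm \<omega> > real n")
        case True
        have "norm (h x *\<^sub>R (\<psi> ?t - f ?t)) \<le> norm (feature h \<psi> \<omega> x)"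
          using f(4)[of ?t] by (simp add: feature_def mult_left_mono)
        then have "(norm (h x *\<^sub>R (\<psi> ?t - f ?t)))\<^sup>2 \<le> (norm (feature h \<psi> \<omega> x))\<^sup>2"
          by (intro power_mono) auto
        also have "\<dots> \<le> g \<omega>" by (rule dom[OF x])
        also have "\<dots> = g \<omega> * indicator {\<omega>. norm \<omega> > real n} \<omega>" using True by simp
        finally show ?thesis .
      next
        case False
        have "\<bar>?t\<bar> \<le> norm \<omega> * norm x" by (rule Cauchy_Schwarz_ineq2)
        also have "\<dots> \<le> real n * R" using False R(2)[OF x] by (intro mult_mono) auto
        also have "\<dots> \<le> T" by (simp add: T_def)
        finally have "f ?t = \<psi> ?t" by (rule f(3))
        then show ?thesis using g0[of \<omega>] by simp
      qed
      have 2: "(norm (h x *\<^sub>R (f ?t - N ?t)))\<^sup>2 \<le> (H\<^sup>2 * \<delta>\<^sup>2) * e \<omega>"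
      proof -
        have "norm (h x *\<^sub>R (f ?t - N ?t)) \<le> H * (\<delta> * exp (c * ?t\<^sup>2))"
          unfolding norm_scaleR using H N(2) H(2)[OF x] by (intro mult_mono) auto
        then have "(norm (h x *\<^sub>R (f ?t - N ?t)))\<^sup>2 \<le> (H * (\<delta> * exp (c * ?t\<^sup>2)))\<^sup>2"
          by (intro power_mono) auto
        also have "\<dots> = (H\<^sup>2 * \<delta>\<^sup>2) * (exp (c * ?t\<^sup>2))\<^sup>2" by (simp add: power_mult_distrib)
        also have "\<dots> \<le> (H\<^sup>2 * \<delta>\<^sup>2) * e \<omega>" using exp_le[OF x] by (intro mult_left_mono) auto
        finally show ?thesis .
      qed
      have 3: "(norm ((h x - hN x) *\<^sub>R N ?t))\<^sup>2 \<le> (A\<^sup>2 * \<theta>\<^sup>2) * e \<omega>"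
      proof -
        have "norm ((h x - hN x) *\<^sub>R N ?t) \<le> \<theta> * (A * exp (c * ?t\<^sup>2))"
          unfolding norm_scaleR using hN(2)[OF x] N_bound \<theta>(1) by (intro mult_mono) auto
        then have "(norm ((h x - hN x) *\<^sub>R N ?t))\<^sup>2 \<le> (\<theta> * (A * exp (c * ?t\<^sup>2)))\<^sup>2"
          by (intro power_mono) auto
        also have "\<dots> = (A\<^sup>2 * \<theta>\<^sup>2) * (exp (c * ?t\<^sup>2))\<^sup>2" by (simp add: power_mult_distrib)
        also have "\<dots> \<le> (A\<^sup>2 * \<theta>\<^sup>2) * e \<omega>" using exp_le[OF x] by (intro mult_left_mono) auto
        finally show ?thesis .
      qed
      have "(norm (feature h \<psi> \<omega> x - feature hN N \<omega> x))\<^sup>2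
          \<le> 3 * (norm (h x *\<^sub>R (\<psi> ?t - f ?t)))\<^sup>2 + 3 * (norm (h x *\<^sub>R (f ?t - N ?t)))\<^sup>2
            + 3 * (norm ((h x - hN x) *\<^sub>R N ?t))\<^sup>2"
        unfolding split by (rule norm_sum3_square_le)
      also have "\<dots> \<le> 3 * (g \<omega> * indicator {\<omega>. norm \<omega> > real n} \<omega>)
          + 3 * ((H\<^sup>2 * \<delta>\<^sup>2) * e \<omega>) + 3 * ((A\<^sup>2 * \<theta>\<^sup>2) * e \<omega>)"
        by (intro add_mono mult_left_mono 1 2 3) auto
      also have "\<dots> = E \<omega>" by (simp only: E_def mult.assoc)
      finally show "(norm (feature h \<psi> \<omega> x - feature hN N \<omega> x))\<^sup>2 \<le> E \<omega>" .
    qed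
  qed
qed

section \<open>From feature errors to the kernel error\<close>

theorem proposition6:
  fixes K :: "(real ^ 'd) set"
    and k :: "real ^ 'd \<Rightarrow> real ^ 'd \<Rightarrow> real"
    and h :: "real ^ 'd \<Rightarrow> real"
    and k' :: "real ^ 'd \<Rightarrow> real"
    and \<psi> :: "real \<Rightarrow> real ^ 'D"
    and g :: "real ^ 'd \<Rightarrow> real"
    and \<sigma> \<sigma>' :: "real \<Rightarrow> real"
    and \<epsilon> :: real
  assumes "compact K"
    and "positive_definite_kernel k"
    and "\<And>x y. k x y = h x * k' (x - y) * h y"
    and "\<And>x y. k x y = feature_kernel h \<psi> x y"
    and "continuous_on UNIV h"
    and "continuous_on UNIV (\<lambda>(\<omega>, x). feature h \<psi> \<omega> x)"
    and "\<And>\<omega>. bdd_above ((\<lambda>x. (norm (feature h \<psi> \<omega> x))\<^sup>2) ` K)"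
    and "\<And>\<omega>. g \<omega> = (SUP x\<in>K. (norm (feature h \<psi> \<omega> x))\<^sup>2)"
    and "integrable std_gaussian g"
    and "lipschitz \<sigma>" and "\<not> bounded (range \<sigma>)" and "non_polynomial \<sigma>"
    and "lipschitz \<sigma>'" and "non_polynomial \<sigma>'"
    and "\<epsilon> > 0"
  shows "\<exists>(h\<^sub>N\<^sub>N :: real ^ 'd \<Rightarrow> real) (\<psi>\<^sub>N\<^sub>N :: real \<Rightarrow> real ^ 'D).
           one_hidden_layer_mlp \<sigma>' h\<^sub>N\<^sub>N \<and>
           one_hidden_layer_mlp \<sigma> \<psi>\<^sub>N\<^sub>N \<and>
           (\<forall>x y. integrable std_gaussian
              (\<lambda>\<omega>. feature h\<^sub>N\<^sub>N \<psi>\<^sub>N\<^sub>N \<omega> x \<bullet> feature h\<^sub>N\<^sub>N \<psi>\<^sub>N\<^sub>N \<omega> y)) \<and>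
           (\<forall>x\<in>K. \<forall>y\<in>K. \<bar>k x y - feature_kernel h\<^sub>N\<^sub>N \<psi>\<^sub>N\<^sub>N x y\<bar> \<le> \<epsilon>)"
proof (cases "K = {} \<or> (\<forall>x. h x = 0)")
  \<comment> \<open>For empty \<open>K\<close> there is nothing to approximate, and if
    \<open>h\<close> vanishes identically then so does \<open>k\<close>; zero networks serve both.
    The other case supplies a point of \<open>K\<close>, which gives
    \<open>0 \<le> g \<omega>\<close>, and a zero-free value of \<open>h\<close>, which gives
    continuity of \<open>\<psi>\<close>.\<close>
  case True
  show ?thesis
  proof (intro exI conjI)
    show "one_hidden_layer_mlp \<sigma>' (\<lambda>x :: real ^ 'd. 0 :: real)"
      and "one_hidden_layer_mlp \<sigma> (\<lambda>t. 0 :: real ^ 'D)"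
      by (rule mlp_zero)+
    show "\<forall>x y. integrable std_gaussian
        (\<lambda>\<omega>. feature (\<lambda>x :: real ^ 'd. 0) (\<lambda>t. 0 :: real ^ 'D) \<omega> x \<bullet> feature (\<lambda>x. 0) (\<lambda>t. 0) \<omega> y)"
      by (simp add: feature_def)
    show "\<forall>x\<in>K. \<forall>y\<in>K. \<bar>k x y - feature_kernel (\<lambda>x. 0) (\<lambda>t. 0 :: real ^ 'D) x y\<bar> \<le> \<epsilon>"
      using True assms(3) \<open>\<epsilon> > 0\<close> by (auto simp: feature_kernel_def feature_def)
  qed
next
  case False
  then obtain x0 z0 where nz: "z0 \<in> K" "h x0 \<noteq> 0" by blast
  have \<psi>: "continuous_on UNIV \<psi>"
    using assms(5) nz(2) assms(6) by (rule feature_continuous_imp_continuous)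
  have dom: "(norm (feature h \<psi> \<omega> x))\<^sup>2 \<le> g \<omega>" if "x \<in> K" for x \<omega>
    unfolding assms(8) using that assms(7) by (rule cSUP_upper)
  have g0: "0 \<le> g \<omega>" for \<omega> using dom[OF nz(1), of \<omega>] by (rule order_trans[OF zero_le_power2])
  define \<Gamma> where "\<Gamma> = (\<integral>\<omega>. g \<omega> \<partial>std_gaussian)"
  have \<Gamma>: "\<Gamma> \<ge> 0" unfolding \<Gamma>_def using g0 by (intro Bochner_Integration.integral_nonneg) auto
  \<comment> \<open>All constants precede the networks: \<open>l\<close> makes the part
    \<open>l * \<Gamma>\<close> at most \<open>\<epsilon> / 2\<close>, \<open>r\<close> is the
    resulting factor of \<open>E\<close> in \<open>inner_perturbation\<close>, and
    \<open>\<eta>\<close> makes \<open>r * \<eta>\<close> the other half.\<close>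
  define l where "l = \<epsilon> / (2 * (\<Gamma> + 1))"
  have l: "l > 0" using \<Gamma> \<open>\<epsilon> > 0\<close> by (simp add: l_def)
  have l\<Gamma>: "l * \<Gamma> \<le> \<epsilon> / 2" using \<Gamma> \<open>\<epsilon> > 0\<close> by (simp add: l_def field_simps)
  define r where "r = 1 / l + 1"
  have r: "r > 0" using l by (simp add: r_def add_pos_pos)
  define \<eta> where "\<eta> = \<epsilon> / (2 * r)"
  have \<eta>: "\<eta> > 0" "r * \<eta> = \<epsilon> / 2" using r \<open>\<epsilon> > 0\<close> by (auto simp: \<eta>_def)
  obtain hN N E where N: "one_hidden_layer_mlp \<sigma>' hN" "one_hidden_layer_mlp \<sigma> N"
    "integrable std_gaussian E" "(\<integral>\<omega>. E \<omega> \<partial>std_gaussian) \<le> \<eta>"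
    "\<forall>x\<in>K. \<forall>\<omega>. (norm (feature h \<psi> \<omega> x - feature hN N \<omega> x))\<^sup>2 \<le> E \<omega>"
    using feature_mlp_approx[OF assms(1,5) \<psi> assms(9) dom g0 assms(10,12,13,14) \<eta>(1)] .
  note NE = N(5)[rule_format]
  obtain C where C: "C \<ge> 0" "\<And>t. norm (N t) \<le> C * (1 + \<bar>t\<bar>)"
    using mlp_linear_growth[OF N(2) assms(10)] by blast
  have N_int: "integrable std_gaussian (\<lambda>\<omega>. feature hN N \<omega> x \<bullet> feature hN N \<omega> y)" for x y
    using mlp_continuous[OF N(2) assms(10)] C by (rule integrable_feature_inner_linear_growth)
  have "\<bar>k x y - feature_kernel hN N x y\<bar> \<le> \<epsilon>" if xy: "x \<in> K" "y \<in> K" for x y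
  proof -
    have \<phi>_int: "integrable std_gaussian (\<lambda>\<omega>. feature h \<psi> \<omega> x \<bullet> feature h \<psi> \<omega> y)"
    proof (rule Bochner_Integration.integrable_bound[OF assms(9)])
      show "AE \<omega> in std_gaussian. norm (feature h \<psi> \<omega> x \<bullet> feature h \<psi> \<omega> y) \<le> norm (g \<omega>)"
      proof (rule AE_I2)
        fix \<omega> :: "real ^ 'd"
        show "norm (feature h \<psi> \<omega> x \<bullet> feature h \<psi> \<omega> y) \<le> norm (g \<omega>)"
          using abs_inner_weighted_AM_GM[of 1 "feature h \<psi> \<omega> x" "feature h \<psi> \<omega> y"]
            dom[OF xy(1), of \<omega>] dom[OF xy(2), of \<omega>] by simp
      qed
    qed (rule feature_inner_measurable[OF \<psi>])
    have "\<bar>k x y - feature_kernel hN N x y\<bar>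
        = \<bar>\<integral>\<omega>. feature h \<psi> \<omega> x \<bullet> feature h \<psi> \<omega> y - feature hN N \<omega> x \<bullet> feature hN N \<omega> y \<partial>std_gaussian\<bar>"
      unfolding assms(4) feature_kernel_def using \<phi>_int N_int by simp
    also have "\<dots> \<le> (\<integral>\<omega>. l * g \<omega> + r * E \<omega> \<partial>std_gaussian)"
    proof (rule Bochner_Integration.integral_abs_bound_integral)
      show "integrable std_gaussian
          (\<lambda>\<omega>. feature h \<psi> \<omega> x \<bullet> feature h \<psi> \<omega> y - feature hN N \<omega> x \<bullet> feature hN N \<omega> y)"
        using \<phi>_int N_int by simp
      show "integrable std_gaussian (\<lambda>\<omega>. l * g \<omega> + r * E \<omega>)"
        using assms(9) N(3) by simp
    qed (rule inner_perturbation[OF l, folded r_def,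
          OF dom[OF xy(1)] dom[OF xy(2)] NE[OF xy(1)] NE[OF xy(2)]])
    also have "\<dots> = l * \<Gamma> + r * (\<integral>\<omega>. E \<omega> \<partial>std_gaussian)"
      using assms(9) N(3) by (simp add: \<Gamma>_def)
    also have "\<dots> \<le> \<epsilon> / 2 + r * \<eta>"
      using l\<Gamma> N(4) r by (intro add_mono mult_left_mono) auto
    also have "\<dots> = \<epsilon>" by (simp add: \<eta>(2))
    finally show ?thesis .
  qed
  with N(1,2) N_int show ?thesis by (intro exI[of _ hN] exI[of _ N]) auto
qed

end
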